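(* Define the five sets of patterns $$\Pi_1=\{1234,1243,1342\},\quad \Pi_2=\{1243,1324,1342\},\quad \Pi_3=\{1324,1342,1432\},$$ $$\Pi_4=\{2314,3214,4213\},\quad \Pi_5=\{3214,3241,4213\}.$$ Then, for every $j\in\{1,2,3,4,5\}$, $$\sum_{n\geq 0}\#S_n(\Pi_j)\,x^n=\frac{1-5x+(1+x)\sqrt{1-4x}}{1-5x+(1-x)\sqrt{1-4x}}$$ as formal power series in $x$.
   Context: $S_n$ is the set of permutations $\pi=\pi_1\pi_2\cdots\pi_n$ of $\{1,\dots,n\}$ in one-line notation ($S_0$ consists of the empty permutation). For $\tau\in S_k$, $\pi\in S_n$ contains $\tau$ if there are indices $1\le i_1<\cdots<i_k\le n$ such that $\pi_{i_1}\cdots\pi_{i_k}$ is order-isomorphic to $\tau$; otherwise $\pi$ avoids $\tau$. For a finite set $T$ of patterns, $S_n(T)$ is the set of $\pi\in S_n$ that avoid every $\tau\in T$. $\sqrt{1-4x}$ denotes the formal power series square root of $1-4x$ with constant term $1$. *)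

theory Defs
  imports
    Complex_Main
    "HOL-Combinatorics.Multiset_Permutations"
    "HOL-Computational_Algebra.Formal_Power_Series"
begin

definition order_isomorphic :: "nat list \<Rightarrow> nat list \<Rightarrow> bool" where
  "order_isomorphic xs ys \<longleftrightarrow> length xs = length ys \<and>
     (\<forall>a < length xs. \<forall>b < length xs. xs ! a < xs ! b \<longleftrightarrow> ys ! a < ys ! b)"

(* is = [i_1, ..., i_k] lists the (0-based) positions i_1 < ... < i_k of an occurrence of \<tau>;
   its length k is forced by order_isomorphic. *)
definition contains :: "nat list \<Rightarrow> nat list \<Rightarrow> bool" where
  "contains \<pi> \<tau> \<longleftrightarrow>
     (\<exists>is. sorted_wrt (<) is \<and> set is \<subseteq> {..<length \<pi>} \<and>
           order_isomorphic (map ((!) \<pi>) is) \<tau>)"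

definition avoids :: "nat list \<Rightarrow> nat list \<Rightarrow> bool" where
  "avoids \<pi> \<tau> \<longleftrightarrow> \<not> contains \<pi> \<tau>"

definition avoiders :: "nat \<Rightarrow> nat list set \<Rightarrow> nat list set" where
  "avoiders n T = {\<pi> \<in> permutations_of_set {1..n}. \<forall>\<tau>\<in>T. avoids \<pi> \<tau>}"

definition avoiders_gf :: "nat list set \<Rightarrow> real fps" where
  "avoiders_gf T = Abs_fps (\<lambda>n. of_nat (card (avoiders n T)))"

definition Pi1 :: "nat list set" where "Pi1 = {[1,2,3,4], [1,2,4,3], [1,3,4,2]}"
definition Pi2 :: "nat list set" where "Pi2 = {[1,2,4,3], [1,3,2,4], [1,3,4,2]}"
definition Pi3 :: "nat list set" where "Pi3 = {[1,3,2,4], [1,3,4,2], [1,4,3,2]}"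
definition Pi4 :: "nat list set" where "Pi4 = {[2,3,1,4], [3,2,1,4], [4,2,1,3]}"
definition Pi5 :: "nat list set" where "Pi5 = {[3,2,1,4], [3,2,4,1], [4,2,1,3]}"

definition sqrt_1_minus_4X :: "real fps" where
  "sqrt_1_minus_4X = fps_radical root 2 (1 - 4 * fps_X)"

lemma sqrt_1_minus_4X_unique:
  "s = sqrt_1_minus_4X \<longleftrightarrow> s\<^sup>2 = 1 - 4 * fps_X \<and> fps_nth s 0 = 1"
proof -
  let ?b = "1 - 4 * fps_X :: real fps"
  have b0: "fps_nth ?b 0 = 1" by simp
  have "s\<^sup>2 = ?b \<longleftrightarrow> s = sqrt_1_minus_4X" if "fps_nth s 0 = 1"
    using radical_unique[of root 1 ?b s] that b0
    by (simp add: sqrt_1_minus_4X_def numeral_2_eq_2)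
  moreover have "fps_nth sqrt_1_minus_4X 0 = 1"
    by (simp add: sqrt_1_minus_4X_def)
  ultimately show ?thesis by blast
qed

end

theory Submission
  imports Defs "HOL-Library.Sublist"
begin

text \<open>
  A permutation of size \<open>n + 1\<close> arises from one of size \<open>n\<close> by prepending a value \<open>v\<close> and raising
  the entries \<open>\<ge> v\<close>. For each of the five classes (for \<open>\<Pi>\<^sub>4\<close> and \<open>\<Pi>\<^sub>5\<close> after reversing the patterns)
  the admissible values \<open>v\<close> form an interval, and a few statistics of the permutation determine
  this interval and the statistics of all children. If formal power series are attached to
  permutations so that the series at \<open>w\<close> is \<open>1\<close> plus \<open>x\<close> times the sum of the series at the
  children of \<open>w\<close>, then the series at \<open>w\<close> counts the descendants of \<open>w\<close>, and the one at the
  empty permutation is the generating function. Solving the resulting recurrences by the kernel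
  method gives explicit series in the Catalan series \<open>C = 1 + x C\<^sup>2\<close>, and in all five cases the
  value at the root is \<open>1 + (C - 1) (2 - C) / (1 + C - C\<^sup>2)\<close>.
\<close>

section \<open>Generating trees\<close>

lemma subseq_map_iff: "subseq s (map f w) \<longleftrightarrow> (\<exists>t. subseq t w \<and> s = map f t)"
  by (auto simp: subseq_conv_nths nths_map)

lemma subseq_rev_iff: "subseq (rev s) (rev w) \<longleftrightarrow> subseq s w"
proof -
  have rev: "subseq (rev s) (rev w)" if "subseq s w" for s w :: "'b list"
    using that by (induction rule: list_emb.induct) (auto intro: subseq_rev_drop_many)
  show ?thesis
    using rev[of s w] rev[of "rev s" "rev w"] by auto
qed

lemma subseq_upt_iff: "subseq is [0..<n] \<longleftrightarrow> sorted_wrt (<) is \<and> set is \<subseteq> {..<n}"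
proof
  assume "subseq is [0..<n]"
  then obtain N where "is = nths [0..<n] N"
    by (auto simp: subseq_conv_nths)
  then show "sorted_wrt (<) is \<and> set is \<subseteq> {..<n}"
    by (auto simp: strict_sorted_iff sorted_nths dest: in_set_nthsD)
next
  assume "sorted_wrt (<) is \<and> set is \<subseteq> {..<n}"
  then show "subseq is [0..<n]"
    by (intro sorted_subset_imp_subseq) (auto simp: strict_sorted_iff)
qed

lemma contains_iff_subseq: "contains w \<tau> \<longleftrightarrow> (\<exists>s. subseq s w \<and> order_isomorphic s \<tau>)"
proof -
  have "contains w \<tau> \<longleftrightarrow> (\<exists>is. subseq is [0..<length w] \<and> order_isomorphic (map ((!) w) is) \<tau>)"
    by (simp add: contains_def subseq_upt_iff conj_assoc)
  also have "\<dots> \<longleftrightarrow> (\<exists>s. subseq s (map ((!) w) [0..<length w]) \<and> order_isomorphic s \<tau>)"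
    unfolding subseq_map_iff by blast
  finally show ?thesis
    by (simp only: map_nth)
qed

lemma order_isomorphic_map:
  "strict_mono f \<Longrightarrow> order_isomorphic (map f s) \<tau> \<longleftrightarrow> order_isomorphic s \<tau>"
  by (simp add: order_isomorphic_def strict_mono_less)

lemma order_isomorphic_rev:
  "order_isomorphic (rev s) (rev \<tau>) \<longleftrightarrow> order_isomorphic s \<tau>"
proof -
  have rev: "order_isomorphic (rev s) (rev \<tau>)" if "order_isomorphic s \<tau>" for s \<tau>
    using that by (auto simp: order_isomorphic_def rev_nth)
  show ?thesis
    using rev[of s \<tau>] rev[of "rev s" "rev \<tau>"] by auto
qed

definition matches :: "nat list set \<Rightarrow> nat list \<Rightarrow> bool" where
  "matches T s \<longleftrightarrow> (\<exists>\<tau>\<in>T. order_isomorphic s \<tau>)"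

lemma matches_map: "strict_mono f \<Longrightarrow> matches T (map f s) \<longleftrightarrow> matches T s"
  by (simp add: matches_def order_isomorphic_map)

lemma matches_rev: "matches (rev ` T) (rev s) \<longleftrightarrow> matches T s"
  by (simp add: matches_def order_isomorphic_rev)

lemma avoids_all_iff: "(\<forall>\<tau>\<in>T. avoids w \<tau>) \<longleftrightarrow> (\<forall>s. subseq s w \<longrightarrow> \<not> matches T s)"
  by (auto simp: avoids_def contains_iff_subseq matches_def)

lemma avoids_all_rev: "(\<forall>\<tau>\<in>rev ` T. avoids (rev w) \<tau>) \<longleftrightarrow> (\<forall>\<tau>\<in>T. avoids w \<tau>)"
proof -
  have rev: "(\<forall>s. P s) \<longleftrightarrow> (\<forall>s. P (rev s))" for P :: "nat list \<Rightarrow> bool"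
    by (metis rev_rev_ident)
  show ?thesis
    unfolding avoids_all_iff rev[of "\<lambda>s. subseq s (rev w) \<longrightarrow> \<not> matches (rev ` T) s"]
    by (simp only: subseq_rev_iff matches_rev)
qed

lemma avoiders_gf_rev: "avoiders_gf (rev ` T) = avoiders_gf T"
proof -
  have "avoiders n (rev ` T) = rev ` avoiders n T" for n
  proof -
    have "avoiders n (rev ` T) = {w \<in> rev ` permutations_of_set {1..n}. \<forall>\<tau>\<in>rev ` T. avoids w \<tau>}"
      unfolding avoiders_def by simp
    also have "\<dots> = rev ` avoiders n T"
      using avoids_all_rev[of T] by (auto simp: avoiders_def simp del: rev_permutations_of_set)
    finally show ?thesis .
  qed
  then show ?thesis
    by (simp add: avoiders_gf_def card_image)
qed

definition bump :: "nat \<Rightarrow> nat \<Rightarrow> nat" where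
  "bump v y = (if y < v then y else Suc y)"

definition unbump :: "nat \<Rightarrow> nat \<Rightarrow> nat" where
  "unbump v y = (if y \<le> v then y else y - 1)"

lemma strict_mono_bump: "strict_mono (bump v)"
  by (rule strict_monoI) (simp add: bump_def)

lemma bump_less_iff [simp]: "bump v a < bump v b \<longleftrightarrow> a < b"
  by (rule strict_mono_less[OF strict_mono_bump])

lemma bump_eq_iff [simp]: "bump v a = bump v b \<longleftrightarrow> a = b"
  by (rule strict_mono_eq[OF strict_mono_bump])

lemma bump_neq [simp]: "bump v a \<noteq> v" "v \<noteq> bump v a"
  by (auto simp: bump_def)

lemma bump_less_self_iff [simp]: "bump v a < v \<longleftrightarrow> a < v" "v < bump v a \<longleftrightarrow> v \<le> a"
  by (auto simp: bump_def)

lemma bump_unbump: "y \<noteq> v \<Longrightarrow> bump v (unbump v y) = y"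
  by (auto simp: bump_def unbump_def)

lemma le_bump_iff: "u \<le> bump v b \<longleftrightarrow> unbump v u \<le> b"
  by (auto simp: bump_def unbump_def)

lemma bump_image: "v \<in> {1..Suc n} \<Longrightarrow> bump v ` {1..n} = {1..Suc n} - {v}"
proof (intro equalityI subsetI)
  fix y assume "v \<in> {1..Suc n}" and y: "y \<in> {1..Suc n} - {v}"
  then have "unbump v y \<in> {1..n}"
    by (auto simp: unbump_def)
  then show "y \<in> bump v ` {1..n}"
    using y bump_unbump[of y v] by (metis DiffD2 image_eqI singletonI)
qed (auto simp: bump_def)

definition prepend :: "nat \<Rightarrow> nat list \<Rightarrow> nat list" where
  "prepend v w = v # map (bump v) w"

lemma length_prepend [simp]: "length (prepend v w) = Suc (length w)"
  by (simp add: prepend_def)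

lemma prepend_neq_Nil [simp]: "prepend v w \<noteq> []"
  by (simp add: prepend_def)

lemma prepend_eq_iff [simp]: "prepend v w = prepend v' w' \<longleftrightarrow> v = v' \<and> w = w'"
  by (auto simp: prepend_def inj_map_eq_map[OF strict_mono_imp_inj_on[OF strict_mono_bump]])

lemma subseq_prepend_iff:
  "subseq s (prepend v w) \<longleftrightarrow> (\<exists>t. subseq t w \<and> (s = map (bump v) t \<or> s = prepend v t))"
proof -
  have "subseq s (v # u) \<longleftrightarrow> subseq s u \<or> (\<exists>s'. subseq s' u \<and> s = v # s')" for u
    by (auto elim: list_emb.cases)
  then have "subseq s (prepend v w) \<longleftrightarrow>
      subseq s (map (bump v) w) \<or> (\<exists>s'. subseq s' (map (bump v) w) \<and> s = v # s')"
    unfolding prepend_def .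
  then show ?thesis
    unfolding subseq_map_iff prepend_def by fast
qed

abbreviation perms :: "nat \<Rightarrow> nat list set" where
  "perms n \<equiv> permutations_of_set {1..n}"

lemma permsD:
  assumes "w \<in> perms n"
  shows "distinct w" "set w = {1..n}" "length w = n"
  using permutations_of_setD[OF assms] length_finite_permutations_of_set[OF assms] by simp_all

lemma prepend_in_perms: "w \<in> perms n \<Longrightarrow> v \<in> {1..Suc n} \<Longrightarrow> prepend v w \<in> perms (Suc n)"
  using bump_image[of v n]
  by (auto simp: permutations_of_set_def prepend_def distinct_map inj_on_def)

lemma perms_SucE:
  assumes "x \<in> perms (Suc n)"
  obtains v w where "x = prepend v w" "v \<in> {1..Suc n}" "w \<in> perms n"
proof -
  obtain v u where x: "x = v # u"
    using permsD(3)[OF assms] by (cases x) simp_all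
  then have "insert v (set u) = {1..Suc n}" "distinct u" "v \<notin> set u"
    using permsD(1,2)[OF assms] by simp_all
  then have v: "v \<in> {1..Suc n}" and u: "distinct u" "set u = {1..Suc n} - {v}"
    by blast+
  define w where "w = map (unbump v) u"
  have "map (bump v) w = u"
    unfolding w_def map_map comp_def using u(2) by (intro map_idI bump_unbump) auto
  then have w: "u = map (bump v) w" ..
  have "bump v ` set w = bump v ` {1..n}"
    using u(2) w bump_image[OF v] by simp
  then have "set w = {1..n}"
    by (simp only: inj_image_eq_iff[OF strict_mono_imp_inj_on[OF strict_mono_bump]])
  then have "w \<in> perms n" "x = prepend v w"
    using u(1) x w by (simp_all add: permutations_of_set_def prepend_def distinct_map)
  then show thesis
    using that v by blast
qed

definition sites :: "nat list set \<Rightarrow> nat list \<Rightarrow> nat set" where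
  "sites T w = {v \<in> {1..Suc (length w)}. \<forall>s. subseq s w \<longrightarrow> \<not> matches T (prepend v s)}"

lemma finite_sites [simp]: "finite (sites T w)"
  by (simp add: sites_def)

lemma prepend_site_in_perms: "w \<in> perms n \<Longrightarrow> v \<in> sites T w \<Longrightarrow> prepend v w \<in> perms (Suc n)"
  by (rule prepend_in_perms) (simp_all add: sites_def permsD(3))

lemma prepend_in_avoiders_iff:
  assumes w: "w \<in> perms n" and v: "v \<in> {1..Suc n}"
  shows "prepend v w \<in> avoiders (Suc n) T \<longleftrightarrow> w \<in> avoiders n T \<and> v \<in> sites T w"
proof -
  have "(\<forall>\<tau>\<in>T. avoids (prepend v w) \<tau>) \<longleftrightarrow>
      (\<forall>s. subseq s w \<longrightarrow> \<not> matches T (map (bump v) s) \<and> \<not> matches T (prepend v s))"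
    unfolding avoids_all_iff subseq_prepend_iff by blast
  also have "\<dots> \<longleftrightarrow> (\<forall>\<tau>\<in>T. avoids w \<tau>) \<and> v \<in> sites T w"
    using v unfolding avoids_all_iff sites_def matches_map[OF strict_mono_bump] permsD(3)[OF w]
    by blast
  finally show ?thesis
    using w prepend_in_perms[OF w v] by (simp add: avoiders_def)
qed

lemma avoiders_Suc:
  "avoiders (Suc n) T = (\<lambda>(w, v). prepend v w) ` (SIGMA w:avoiders n T. sites T w)"
proof (intro equalityI subsetI)
  fix x assume x: "x \<in> avoiders (Suc n) T"
  then have "x \<in> perms (Suc n)"
    by (simp add: avoiders_def)
  then obtain v w where "x = prepend v w" "v \<in> {1..Suc n}" "w \<in> perms n"
    by (rule perms_SucE)
  then show "x \<in> (\<lambda>(w, v). prepend v w) ` (SIGMA w:avoiders n T. sites T w)"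
    using x prepend_in_avoiders_iff by (intro image_eqI[of _ _ "(w, v)"]) auto
next
  fix x assume "x \<in> (\<lambda>(w, v). prepend v w) ` (SIGMA w:avoiders n T. sites T w)"
  then obtain w v where x: "x = prepend v w" "w \<in> avoiders n T" "v \<in> sites T w"
    by auto
  then have "w \<in> perms n" "v \<in> {1..Suc n}"
    using permsD(3)[of w n] by (auto simp: avoiders_def sites_def)
  then show "x \<in> avoiders (Suc n) T"
    using x prepend_in_avoiders_iff by blast
qed

primrec num_descendants :: "nat list set \<Rightarrow> nat \<Rightarrow> nat list \<Rightarrow> nat" where
  "num_descendants T 0 w = 1"
| "num_descendants T (Suc m) w = (\<Sum>v\<in>sites T w. num_descendants T m (prepend v w))"

lemma card_avoiders_add: "card (avoiders (n + m) T) = (\<Sum>w\<in>avoiders n T. num_descendants T m w)"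
proof (induction m arbitrary: n)
  case (Suc m)
  have "card (avoiders (n + Suc m) T) = (\<Sum>w\<in>avoiders (Suc n) T. num_descendants T m w)"
    using Suc[of "Suc n"] by simp
  also have "\<dots> = (\<Sum>(w, v)\<in>(SIGMA w:avoiders n T. sites T w). num_descendants T m (prepend v w))"
    unfolding avoiders_Suc by (subst sum.reindex) (auto simp: inj_on_def case_prod_beta)
  also have "\<dots> = (\<Sum>w\<in>avoiders n T. num_descendants T (Suc m) w)"
    by (simp add: sum.Sigma avoiders_def)
  finally show ?case .
qed simp

lemma avoiders_0: "[] \<notin> T \<Longrightarrow> avoiders 0 T = {[]}"
  by (auto simp: avoiders_def avoids_all_iff matches_def order_isomorphic_def dest: list_emb_Nil2)

definition children_sum ::
  "(nat list \<Rightarrow> 'a :: comm_monoid_add \<Rightarrow> bool) \<Rightarrow> nat list \<Rightarrow> nat set \<Rightarrow> 'a \<Rightarrow> bool" where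
  "children_sum R w A s \<longleftrightarrow> (\<exists>H. s = sum H A \<and> (\<forall>v\<in>A. R (prepend v w) (H v)))"

lemma children_sumI:
  "(\<And>v. v \<in> A \<Longrightarrow> R (prepend v w) (H v)) \<Longrightarrow> children_sum R w A (sum H A)"
  by (auto simp: children_sum_def)

lemma children_sum_interval:
  assumes "\<And>t. t < k \<Longrightarrow> R (prepend (l + t) w) (h t)"
  shows "children_sum R w {l..<l + k} (\<Sum>t<k. h t)"
proof -
  have "(\<Sum>t<k. h t) = (\<Sum>v\<in>{l..<l + k}. h (v - l))"
    by (rule sum.reindex_bij_witness[of _ "\<lambda>v. v - l" "\<lambda>t. l + t"]) auto
  moreover have "R (prepend v w) (h (v - l))" if "v \<in> {l..<l + k}" for v
    using assms[of "v - l"] that by auto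
  ultimately show ?thesis
    unfolding children_sum_def by blast
qed

lemma children_sum_append:
  assumes "children_sum R w {l..<m} s" "children_sum R w {m..<k} t" "l \<le> m" "m \<le> k"
  shows "children_sum R w {l..<k} (s + t)"
proof -
  obtain F where F: "s = sum F {l..<m}" "\<And>v. v \<in> {l..<m} \<Longrightarrow> R (prepend v w) (F v)"
    using assms(1) by (auto simp: children_sum_def)
  obtain G where G: "t = sum G {m..<k}" "\<And>v. v \<in> {m..<k} \<Longrightarrow> R (prepend v w) (G v)"
    using assms(2) by (auto simp: children_sum_def)
  define H where "H v = (if v < m then F v else G v)" for v
  have "s = sum H {l..<m}" "t = sum H {m..<k}"
    unfolding F G H_def by (intro sum.cong; simp)+
  then have "s + t = sum H {l..<k}"
    using assms(3,4) by (simp add: sum.atLeastLessThan_concat)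
  then show ?thesis
    using F(2) G(2) by (auto simp: children_sum_def H_def intro!: exI[of _ H])
qed

lemma children_sum_snoc:
  assumes "children_sum R w {l..<m} s" "R (prepend m w) t" "l \<le> m"
  shows "children_sum R w {l..<Suc m} (s + t)"
proof (rule children_sum_append[OF assms(1)])
  show "children_sum R w {m..<Suc m} t"
    using assms(2) by (auto simp: children_sum_def intro!: exI[of _ "\<lambda>_. t"])
qed (use assms(3) in simp_all)

lemma avoiders_gf_eqI:
  assumes T: "[] \<notin> T"
    and root: "R [] G"
    and step: "\<And>n w G. w \<in> perms n \<Longrightarrow> R w G \<Longrightarrow>
      \<exists>s. G = 1 + fps_X * s \<and> children_sum R w (sites T w) s"
  shows "avoiders_gf T = G"
proof -
  have "real (num_descendants T m w) = fps_nth G m" if "w \<in> perms n" "R w G" for m n w G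
    using that
  proof (induction m arbitrary: n w G)
    case 0
    then obtain s where "G = 1 + fps_X * s"
      using step by blast
    then show ?case
      by simp
  next
    case (Suc m)
    obtain H where G: "G = 1 + fps_X * sum H (sites T w)"
      and H: "\<And>v. v \<in> sites T w \<Longrightarrow> R (prepend v w) (H v)"
      using step[OF Suc.prems] unfolding children_sum_def by blast
    have "real (num_descendants T m (prepend v w)) = fps_nth (H v) m" if "v \<in> sites T w" for v
      using Suc.IH[OF prepend_site_in_perms[OF Suc.prems(1) that] H[OF that]] .
    then show ?case
      by (simp add: G fps_sum_nth)
  qed
  from this[of "[]" 0 G] root have "real (num_descendants T m []) = fps_nth G m" for m
    by simp
  then show ?thesis
    using card_avoiders_add[of 0 _ T] by (simp add: avoiders_gf_def avoiders_0[OF T] fps_eq_iff)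
qed

section \<open>Patterns of length four\<close>

definition before :: "'a list \<Rightarrow> 'a \<Rightarrow> 'a \<Rightarrow> bool" where
  "before w a b \<longleftrightarrow> subseq [a, b] w"

lemma before_Nil [simp]: "\<not> before [] a b"
  by (simp add: before_def)

lemma before_Cons:
  "before (x # w) a b \<longleftrightarrow> (if a = x then b \<in> set w else before w a b)"
  by (simp add: before_def subseq_singleton_left)

lemma before_in_set: "before w a b \<Longrightarrow> a \<in> set w \<and> b \<in> set w"
  by (induction w) (auto simp: before_Cons split: if_splits)

lemma before_neq: "distinct w \<Longrightarrow> before w a b \<Longrightarrow> a \<noteq> b"
  by (induction w) (auto simp: before_Cons split: if_splits)

lemma before_asym: "distinct w \<Longrightarrow> before w a b \<Longrightarrow> \<not> before w b a"
  by (induction w) (auto simp: before_Cons split: if_splits dest: before_in_set)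

lemma before_trans: "distinct w \<Longrightarrow> before w a b \<Longrightarrow> before w b c \<Longrightarrow> before w a c"
  by (induction w) (auto simp: before_Cons split: if_splits dest: before_in_set)

lemma before_total:
  "a \<in> set w \<Longrightarrow> b \<in> set w \<Longrightarrow> a \<noteq> b \<Longrightarrow> before w a b \<or> before w b a"
  by (induction w) (auto simp: before_Cons)

lemma before_permsD:
  "w \<in> perms n \<Longrightarrow> before w b c \<Longrightarrow> b \<in> {1..n} \<and> c \<in> {1..n} \<and> b \<noteq> c"
  using before_in_set[of w b c] before_neq[of w b c] permsD[of w n] by auto

lemma subseq_Cons_Cons_iff_before:
  "distinct w \<Longrightarrow> subseq (a # b # s) w \<longleftrightarrow> before w a b \<and> subseq (b # s) w"
proof (induction w)
  case (Cons x w)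
  have "subseq (b # s) w \<Longrightarrow> b \<in> set w"
    by (induction w) (auto split: if_splits)
  then show ?case
    using Cons by (auto simp: before_Cons dest: before_in_set)
qed simp

lemma before_prepend:
  "before (prepend v w) x y \<longleftrightarrow>
     x = v \<and> y \<in> bump v ` set w \<or> (\<exists>a b. x = bump v a \<and> y = bump v b \<and> before w a b)"
proof -
  have "before (map (bump v) w) x y \<longleftrightarrow> (\<exists>a b. x = bump v a \<and> y = bump v b \<and> before w a b)"
    unfolding before_def subseq_map_iff by (auto simp: Cons_eq_map_conv)
  then show ?thesis
    by (auto simp: prepend_def before_Cons)
qed

lemma all_before_prepend:
  "(\<forall>b c. before (prepend v w) b c \<longrightarrow> P b c) \<longleftrightarrow>
    (\<forall>b c. before w b c \<longrightarrow> P (bump v b) (bump v c)) \<and> (\<forall>c\<in>set w. P v (bump v c))"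
  unfolding before_prepend by blast

lemma all_before_before_prepend:
  "(\<forall>b c d. before (prepend v w) b c \<longrightarrow> before (prepend v w) c d \<longrightarrow> P b c d) \<longleftrightarrow>
    (\<forall>b c d. before w b c \<longrightarrow> before w c d \<longrightarrow> P (bump v b) (bump v c) (bump v d)) \<and>
    (\<forall>c d. before w c d \<longrightarrow> P v (bump v c) (bump v d))"
  (is "?L \<longleftrightarrow> ?R")
proof -
  have bump: "before (prepend v w) (bump v c) y \<longleftrightarrow> (\<exists>d. y = bump v d \<and> before w c d)" for c y
    by (auto simp: before_prepend)
  have "?L \<longleftrightarrow> (\<forall>b c. before (prepend v w) b c \<longrightarrow> (\<forall>d. before (prepend v w) c d \<longrightarrow> P b c d))"
    by blast
  also have "\<dots> \<longleftrightarrow> ?R"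
    unfolding all_before_prepend bump using before_in_set[of w] by blast
  finally show ?thesis .
qed

lemma sites_length_4:
  assumes T: "\<forall>\<tau>\<in>T. length \<tau> = 4" and w: "distinct w"
  shows "sites T w = {v \<in> {1..Suc (length w)}. \<forall>b c d. before w b c \<longrightarrow> before w c d \<longrightarrow>
    \<not> matches T [v, bump v b, bump v c, bump v d]}"
proof -
  have "\<exists>b c d. s = [b, c, d]" if "matches T (prepend v s)" for v s
  proof -
    have "length s = Suc (Suc (Suc 0))"
      using that T by (auto simp: matches_def order_isomorphic_def)
    then show ?thesis
      by (auto simp: length_Suc_conv)
  qed
  then have "(\<forall>s. subseq s w \<longrightarrow> \<not> matches T (prepend v s)) \<longleftrightarrow>
      (\<forall>b c d. subseq [b, c, d] w \<longrightarrow> \<not> matches T (prepend v [b, c, d]))" for v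
    by blast
  moreover have "subseq [b, c, d] w \<longleftrightarrow> before w b c \<and> before w c d" for b c d
    using w by (auto simp: subseq_Cons_Cons_iff_before subseq_singleton_left dest: before_in_set)
  ultimately show ?thesis
    unfolding sites_def prepend_def by auto
qed

lemma order_isomorphic_Nil: "order_isomorphic [] []"
  by (simp add: order_isomorphic_def)

lemma order_isomorphic_Cons:
  "order_isomorphic (x # xs) (y # ys) \<longleftrightarrow> order_isomorphic xs ys \<and>
    list_all2 (\<lambda>a b. (x < a \<longleftrightarrow> y < b) \<and> (a < x \<longleftrightarrow> b < y)) xs ys"
  by (auto simp: order_isomorphic_def list_all2_conv_all_nth nth_Cons less_Suc_eq_0_disj
      all_conj_distrib split: nat.splits)

lemma order_isomorphic_patterns:
  "order_isomorphic [a, b, c, d] [1, 2, 3, 4] \<longleftrightarrow> a < b \<and> b < c \<and> c < d"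
  "order_isomorphic [a, b, c, d] [1, 2, 4, 3] \<longleftrightarrow> a < b \<and> b < d \<and> d < c"
  "order_isomorphic [a, b, c, d] [1, 3, 2, 4] \<longleftrightarrow> a < c \<and> c < b \<and> b < d"
  "order_isomorphic [a, b, c, d] [1, 3, 4, 2] \<longleftrightarrow> a < d \<and> d < b \<and> b < c"
  "order_isomorphic [a, b, c, d] [1, 4, 2, 3] \<longleftrightarrow> a < c \<and> c < d \<and> d < b"
  "order_isomorphic [a, b, c, d] [1, 4, 3, 2] \<longleftrightarrow> a < d \<and> d < c \<and> c < b"
  "order_isomorphic [a, b, c, d] [3, 1, 2, 4] \<longleftrightarrow> b < c \<and> c < a \<and> a < d"
  "order_isomorphic [a, b, c, d] [4, 1, 2, 3] \<longleftrightarrow> b < c \<and> c < d \<and> d < a"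
  "order_isomorphic [a, b, c, d] [4, 1, 3, 2] \<longleftrightarrow> b < d \<and> d < c \<and> c < a"
  by (simp_all add: order_isomorphic_Cons order_isomorphic_Nil) linarith+

section \<open>Thresholds\<close>

definition up_threshold :: "nat \<Rightarrow> (nat \<Rightarrow> bool) \<Rightarrow> nat \<Rightarrow> bool" where
  "up_threshold n P l \<longleftrightarrow> l \<in> {1..Suc n} \<and> (\<forall>u\<in>{1..Suc n}. P u \<longleftrightarrow> l \<le> u)"

lemma up_thresholdD: "up_threshold n P l \<Longrightarrow> 1 \<le> u \<Longrightarrow> u \<le> Suc n \<Longrightarrow> P u \<longleftrightarrow> l \<le> u"
  by (simp add: up_threshold_def)

lemma up_threshold_prepend:
  assumes l: "up_threshold n P l" and v: "l \<le> v" "v \<le> Suc n" and m: "l \<le> m" "m \<le> Suc v"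
    and P': "\<And>u. P' u \<longleftrightarrow> P (unbump v u) \<and> (u \<le> v \<longrightarrow> S u)"
    and S: "\<And>u. l \<le> u \<Longrightarrow> u \<le> v \<Longrightarrow> S u \<longleftrightarrow> m \<le> u"
  shows "up_threshold (Suc n) P' m"
  unfolding up_threshold_def
proof (intro conjI ballI)
  show "m \<in> {1..Suc (Suc n)}"
    using l v m by (simp add: up_threshold_def)
  fix u assume u: "u \<in> {1..Suc (Suc n)}"
  have "1 \<le> l"
    using l by (simp add: up_threshold_def)
  then have "P (unbump v u) \<longleftrightarrow> l \<le> unbump v u"
    using u v by (intro up_thresholdD[OF l]) (auto simp: unbump_def)
  then show "P' u \<longleftrightarrow> m \<le> u"
    using P'[of u] S[of u] v m by (auto simp: unbump_def)
qed

lemma up_threshold_prepend_below: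
  assumes l: "up_threshold n P l" and v: "1 \<le> v" "v < l"
    and P': "\<And>u. P' u \<longleftrightarrow> P (unbump v u) \<and> (u \<le> v \<longrightarrow> S u)"
  shows "up_threshold (Suc n) P' (Suc l)"
  unfolding up_threshold_def
proof (intro conjI ballI)
  show "Suc l \<in> {1..Suc (Suc n)}"
    using l by (simp add: up_threshold_def)
  fix u assume u: "u \<in> {1..Suc (Suc n)}"
  have "l \<le> Suc n"
    using l by (simp add: up_threshold_def)
  then have "P (unbump v u) \<longleftrightarrow> l \<le> unbump v u"
    using u v by (intro up_thresholdD[OF l]) (auto simp: unbump_def)
  then show "P' u \<longleftrightarrow> Suc l \<le> u"
    using P'[of u] v by (auto simp: unbump_def)
qed

definition down_threshold :: "nat \<Rightarrow> (nat \<Rightarrow> bool) \<Rightarrow> nat \<Rightarrow> bool" where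
  "down_threshold n P m \<longleftrightarrow> m \<in> {1..Suc n} \<and> (\<forall>u\<in>{1..Suc n}. P u \<longleftrightarrow> u \<le> m)"

lemma down_thresholdD: "down_threshold n P m \<Longrightarrow> 1 \<le> u \<Longrightarrow> u \<le> Suc n \<Longrightarrow> P u \<longleftrightarrow> u \<le> m"
  by (simp add: down_threshold_def)

lemma down_threshold_prepend:
  assumes \<beta>: "down_threshold n P \<beta>" and v: "1 \<le> v" "v \<le> m" "m \<le> \<beta>"
    and P': "\<And>u. P' u \<longleftrightarrow> P (unbump v u) \<and> (\<forall>y. B y \<longrightarrow> unbump v u \<le> y)"
    and B: "\<And>y. B y \<Longrightarrow> m \<le> y" "m = \<beta> \<or> B m"
  shows "down_threshold (Suc n) P' (Suc m)"
  unfolding down_threshold_def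
proof (intro conjI ballI)
  have "\<beta> \<le> Suc n"
    using \<beta> by (simp add: down_threshold_def)
  then show "Suc m \<in> {1..Suc (Suc n)}"
    using v by simp
  fix u assume u: "u \<in> {1..Suc (Suc n)}"
  have "P (unbump v u) \<longleftrightarrow> unbump v u \<le> \<beta>"
    using u v \<open>\<beta> \<le> Suc n\<close> by (intro down_thresholdD[OF \<beta>]) (auto simp: unbump_def)
  then have "P' u \<longleftrightarrow> unbump v u \<le> m"
    using P'[of u] B v(3) by (meson le_trans)
  then show "P' u \<longleftrightarrow> u \<le> Suc m"
    using v(2) by (auto simp: unbump_def)
qed

definition avoids_above :: "(nat \<Rightarrow> nat \<Rightarrow> nat \<Rightarrow> bool) \<Rightarrow> nat list \<Rightarrow> nat \<Rightarrow> bool" where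
  "avoids_above R w u \<longleftrightarrow>
     (\<forall>b c d. before w b c \<longrightarrow> before w c d \<longrightarrow> u \<le> b \<longrightarrow> u \<le> c \<longrightarrow> u \<le> d \<longrightarrow> \<not> R b c d)"

lemma avoids_above_prepend:
  assumes "\<And>b c d. R (bump v b) (bump v c) (bump v d) \<longleftrightarrow> R b c d"
  shows "avoids_above R (prepend v w) u \<longleftrightarrow> avoids_above R w (unbump v u) \<and>
    (u \<le> v \<longrightarrow> (\<forall>b c. before w b c \<longrightarrow> u \<le> b \<longrightarrow> u \<le> c \<longrightarrow> \<not> R v (bump v b) (bump v c)))"
  unfolding avoids_above_def all_before_before_prepend le_bump_iff assms
  by (cases "u \<le> v") (simp_all add: unbump_def)

section \<open>The Catalan series\<close>

definition Cat :: "real fps" where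
  "Cat = fps_const (1 / 2) * fps_shift 1 (1 - sqrt_1_minus_4X)"

lemma sqrt_eq_Cat: "sqrt_1_minus_4X = 1 - 2 * fps_X * Cat"
proof -
  let ?s = "sqrt_1_minus_4X"
  have "fps_nth ?s 0 = 1"
    using sqrt_1_minus_4X_unique by blast
  then have "fps_X * fps_shift 1 (1 - ?s) = 1 - ?s"
    by (auto simp: fps_eq_iff)
  moreover have "2 * fps_X * Cat = fps_X * fps_shift 1 (1 - ?s)"
    by (simp add: Cat_def fps_eq_iff numeral_fps_const mult.assoc)
  ultimately show ?thesis
    by simp
qed

lemma Cat_eq: "Cat = 1 + fps_X * Cat\<^sup>2"
proof -
  have "(1 - 2 * fps_X * Cat)\<^sup>2 = 1 - 4 * fps_X"
    using sqrt_1_minus_4X_unique unfolding sqrt_eq_Cat[symmetric] by blast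
  then have "4 * fps_X * (1 + fps_X * Cat\<^sup>2 - Cat) = 0"
    by algebra
  then show ?thesis
    by simp
qed

lemma Cat_nth_0 [simp]: "fps_nth Cat 0 = 1"
  by (subst Cat_eq) simp

lemma Cat_geometric_sum: "fps_X * Cat\<^sup>2 * (\<Sum>t<n. Cat ^ t) = Cat ^ n - 1"
proof -
  have "fps_X * Cat\<^sup>2 = Cat - 1"
    using Cat_eq by algebra
  then show ?thesis
    by (simp add: power_diff_1_eq)
qed

definition inv_quad :: "real fps" where
  "inv_quad = inverse (1 + Cat - Cat\<^sup>2)"

lemma inv_quad: "inv_quad * (1 + Cat - Cat\<^sup>2) = 1"
  unfolding inv_quad_def by (rule inverse_mult_eq_1) (simp add: power2_eq_square)

definition common_gf :: "real fps" where
  "common_gf = 1 + (Cat - 1) * (2 - Cat) * inv_quad"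

lemma common_gf_eq:
  "(1 - 5 * fps_X + (1 + fps_X) * sqrt_1_minus_4X) /
   (1 - 5 * fps_X + (1 - fps_X) * sqrt_1_minus_4X) = common_gf"
proof -
  let ?D = "1 - 5 * fps_X + (1 - fps_X) * sqrt_1_minus_4X"
  have "1 - 5 * fps_X + (1 + fps_X) * sqrt_1_minus_4X = common_gf * ?D"
    using Cat_eq inv_quad unfolding sqrt_eq_Cat common_gf_def by algebra
  moreover have "fps_nth ?D 0 \<noteq> 0"
    by (simp add: sqrt_eq_Cat)
  ultimately show ?thesis
    by (simp add: fps_divide_unit mult.assoc inverse_mult_eq_1')
qed

definition delta :: "real fps" where
  "delta = Cat * (2 - Cat) * inv_quad"

lemma common_gf_eq_delta: "common_gf = 1 + fps_X * (Cat * delta)"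
  unfolding common_gf_def delta_def using Cat_eq by algebra

section \<open>The class of \<open>\<Pi>\<^sub>4\<close>\<close>

definition rl_max :: "nat list \<Rightarrow> nat \<Rightarrow> bool" where
  "rl_max w y \<longleftrightarrow> (\<forall>z. before w y z \<longrightarrow> z < y)"

lemma not_rl_max_iff: "distinct w \<Longrightarrow> \<not> rl_max w y \<longleftrightarrow> (\<exists>z. before w y z \<and> y < z)"
  unfolding rl_max_def by (metis before_neq not_less_iff_gr_or_eq)

lemma rl_max_length: "w \<in> perms n \<Longrightarrow> rl_max w n"
  using before_permsD[of w n n] by (fastforce simp: rl_max_def)

lemma rl_max_prepend_bump: "rl_max (prepend v w) (bump v y) \<longleftrightarrow> rl_max w y"
  by (auto simp: rl_max_def before_prepend)

lemma rl_max_prepend_self: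
  assumes w: "w \<in> perms n" and v: "v \<in> {1..Suc n}"
  shows "rl_max (prepend v w) v \<longleftrightarrow> v = Suc n"
proof -
  have "rl_max (prepend v w) v \<longleftrightarrow> (\<forall>z\<in>{1..n}. z < v)"
    by (auto simp: rl_max_def before_prepend permsD(2)[OF w])
  also have "\<dots> \<longleftrightarrow> v = Suc n"
    using v by (cases "v = Suc n") auto
  finally show ?thesis .
qed

lemma rl_max_prepend:
  assumes "w \<in> perms n" "v \<in> {1..Suc n}"
  shows "rl_max (prepend v w) y \<longleftrightarrow>
    (if y < v then rl_max w y else if y = v then v = Suc n else rl_max w (y - 1))"
  using rl_max_prepend_bump[of v w "unbump v y"] rl_max_prepend_self[OF assms]
  by (auto simp: bump_unbump) (auto simp: unbump_def)

definition no_123_132_below :: "nat list \<Rightarrow> nat \<Rightarrow> bool" where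
  "no_123_132_below w u \<longleftrightarrow> (\<forall>c b a. before w c b \<longrightarrow> before w b a \<longrightarrow> c < b \<longrightarrow> c < a \<longrightarrow> u \<le> b)"

lemma no_123_132_below_prepend:
  "no_123_132_below (prepend v w) u \<longleftrightarrow> no_123_132_below w (unbump v u) \<and>
    (\<forall>b. (\<exists>a. before w b a \<and> v \<le> b \<and> v \<le> a) \<longrightarrow> unbump v u \<le> b)"
  unfolding no_123_132_below_def all_before_before_prepend le_bump_iff by simp blast

lemma matches_rev_Pi4:
  "matches (rev ` Pi4) [v, bump v c, bump v b, bump v a] \<longleftrightarrow> c < b \<and> b < v \<and> c < a \<and> a \<noteq> b"
  unfolding matches_def Pi4_def by (simp add: order_isomorphic_patterns del: One_nat_def) linarith

lemma rev_Pi4_length: "\<forall>\<tau>\<in>rev ` Pi4. length \<tau> = 4"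
  by (simp add: Pi4_def)

lemma sites_rev_Pi4:
  assumes w: "w \<in> perms n" and \<beta>: "down_threshold n (no_123_132_below w) \<beta>"
  shows "sites (rev ` Pi4) w = {1..\<beta>}"
proof -
  have "sites (rev ` Pi4) w = {v \<in> {1..Suc n}. no_123_132_below w v}"
    unfolding sites_length_4[OF rev_Pi4_length permsD(1)[OF w]] matches_rev_Pi4
      no_123_132_below_def permsD(3)[OF w] not_le[symmetric]
    using before_permsD[OF w] by blast
  then show ?thesis
    using \<beta> by (auto simp: down_threshold_def)
qed

definition Pi4_child_threshold :: "nat list \<Rightarrow> nat \<Rightarrow> nat \<Rightarrow> nat" where
  "Pi4_child_threshold w \<beta> v = (if v < \<beta> \<and> rl_max w v then Suc (Suc v) else Suc v)"

lemma no_123_132_below_prepend_threshold: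
  assumes w: "w \<in> perms n" and \<beta>: "down_threshold n (no_123_132_below w) \<beta>" and v: "v \<in> {1..\<beta>}"
  shows "down_threshold (Suc n) (no_123_132_below (prepend v w)) (Pi4_child_threshold w \<beta> v)"
proof -
  define m where "m = (if v < \<beta> \<and> rl_max w v then Suc v else v)"
  have "m = \<beta> \<or> (\<exists>a. before w m a \<and> v \<le> m \<and> v \<le> a)"
  proof (cases "v < \<beta> \<and> rl_max w v \<and> Suc v \<noteq> \<beta>")
    case True
    moreover from this have "v \<in> set w" "Suc v \<in> set w"
      using v \<beta> by (auto simp: down_threshold_def permsD(2)[OF w])
    ultimately have "before w (Suc v) v"
      using before_total[of v w "Suc v"] by (auto simp: rl_max_def)
    then show ?thesis
      using True by (auto simp: m_def)
  next
    case False
    then show ?thesis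
      using v not_rl_max_iff[OF permsD(1)[OF w], of v] by (auto simp: m_def intro: less_imp_le)
  qed
  moreover have "m \<le> b" if "before w b a" "v \<le> b" "v \<le> a" for a b
    using that before_permsD[OF w that(1)] by (cases "b = v") (auto simp: m_def rl_max_def)
  ultimately have "down_threshold (Suc n) (no_123_132_below (prepend v w)) (Suc m)"
    using v by (intro down_threshold_prepend[OF \<beta> _ _ _ no_123_132_below_prepend])
      (auto simp: m_def)
  then show ?thesis
    by (auto simp: m_def Pi4_child_threshold_def)
qed

definition inv_2_Cat :: "real fps" where
  "inv_2_Cat = inverse (2 - Cat)"

lemma inv_2_Cat: "inv_2_Cat * (2 - Cat) = 1"
  unfolding inv_2_Cat_def by (rule inverse_mult_eq_1) simp

lemma Cat_delta_eq: "Cat * delta = 1 + fps_X * (Cat * delta * (Cat + inv_2_Cat))"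
  unfolding delta_def using Cat_eq inv_quad inv_2_Cat by algebra

definition rl_weight :: "nat list \<Rightarrow> nat \<Rightarrow> real fps" where
  "rl_weight w m = (\<Prod>y\<in>{1..<m}. if rl_max w y then inv_2_Cat else Cat)"

lemma rl_weight_1 [simp]: "rl_weight w (Suc 0) = 1"
  by (simp add: rl_weight_def)

lemma rl_weight_Suc:
  "1 \<le> m \<Longrightarrow> rl_weight w (Suc m) = rl_weight w m * (if rl_max w m then inv_2_Cat else Cat)"
  by (simp add: rl_weight_def)

lemma rl_weight_sum:
  assumes "1 \<le> m"
  shows "1 + fps_X * (\<Sum>v\<in>{1..<m}. Cat\<^sup>2 * rl_weight w v * (if rl_max w v then inv_2_Cat else 1)) =
    rl_weight w m"
  using assms
proof (induction m rule: dec_induct)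
  case (step m)
  have "P + fps_X * (Cat\<^sup>2 * P * inv_2_Cat) = P * inv_2_Cat"
    "P + fps_X * (Cat\<^sup>2 * P * 1) = P * Cat" for P
    using Cat_eq inv_2_Cat by algebra+
  from this[of "rl_weight w m"] step show ?case
    by (auto simp: rl_weight_Suc distrib_left add.assoc[symmetric])
qed simp

lemma rl_weight_prepend:
  assumes w: "w \<in> perms n" and v: "v \<in> {1..Suc n}"
  shows "rl_weight (prepend v w) v = rl_weight w v"
    "v \<le> n \<Longrightarrow> rl_weight (prepend v w) (Suc v) = rl_weight w v * Cat"
    "v \<le> n \<Longrightarrow> rl_weight (prepend v w) (Suc (Suc v)) =
      rl_weight w v * Cat * (if rl_max w v then inv_2_Cat else Cat)"
proof -
  show at: "rl_weight (prepend v w) v = rl_weight w v"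
    unfolding rl_weight_def by (intro prod.cong refl) (simp add: rl_max_prepend[OF w v])
  show Suc: "v \<le> n \<Longrightarrow> rl_weight (prepend v w) (Suc v) = rl_weight w v * Cat"
    using v by (simp add: rl_weight_Suc at rl_max_prepend[OF w v])
  show "v \<le> n \<Longrightarrow> rl_weight (prepend v w) (Suc (Suc v)) =
      rl_weight w v * Cat * (if rl_max w v then inv_2_Cat else Cat)"
    by (subst rl_weight_Suc) (simp_all add: Suc rl_max_prepend[OF w v])
qed

definition Pi4_gf :: "nat list \<Rightarrow> nat \<Rightarrow> real fps" where
  "Pi4_gf w \<beta> = (if \<beta> \<le> length w then Cat * rl_weight w \<beta> else if w = [] then common_gf
     else Cat * delta * rl_weight w (length w))"

lemma Pi4_gf_child_below:
  assumes w: "w \<in> perms n" and v: "1 \<le> v" "v < \<beta>" "v < n"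
  shows "Pi4_gf (prepend v w) (Pi4_child_threshold w \<beta> v) =
    Cat\<^sup>2 * rl_weight w v * (if rl_max w v then inv_2_Cat else 1)"
  using v rl_weight_prepend(2,3)[OF w, of v] permsD(3)[OF w]
  by (simp add: Pi4_gf_def Pi4_child_threshold_def power2_eq_square)

lemma Pi4_gf_root: "common_gf = 1 + fps_X * Pi4_gf (prepend 1 []) (Pi4_child_threshold [] 1 1)"
proof -
  have "[] \<in> perms 0"
    by (simp add: permutations_of_set_def)
  then have "rl_weight (prepend 1 []) 1 = 1"
    using rl_weight_prepend(1)[of "[]" 0 1] by simp
  then have "Pi4_gf (prepend 1 []) (Pi4_child_threshold [] 1 1) = Cat * delta"
    by (simp add: Pi4_gf_def Pi4_child_threshold_def)
  then show ?thesis
    by (simp add: common_gf_eq_delta)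
qed

lemma Pi4_gf_partial:
  assumes w: "w \<in> perms n" and \<beta>: "1 \<le> \<beta>" "\<beta> \<le> n"
  shows "Pi4_gf w \<beta> = 1 + fps_X * (\<Sum>v=1..\<beta>. Pi4_gf (prepend v w) (Pi4_child_threshold w \<beta> v))"
    (is "_ = 1 + fps_X * (\<Sum>v=1..\<beta>. ?H v)")
proof -
  have "(\<Sum>v=1..\<beta>. ?H v) = (\<Sum>v\<in>{1..<\<beta>}. ?H v) + ?H \<beta>"
    using \<beta>(1) by (simp add: sum.last_plus atLeastLessThanSuc_atLeastAtMost[symmetric])
  also have "(\<Sum>v\<in>{1..<\<beta>}. ?H v) =
      (\<Sum>v\<in>{1..<\<beta>}. Cat\<^sup>2 * rl_weight w v * (if rl_max w v then inv_2_Cat else 1))"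
    using \<beta> by (intro sum.cong refl Pi4_gf_child_below[OF w]) auto
  also have "?H \<beta> = Cat\<^sup>2 * rl_weight w \<beta>"
    using \<beta> rl_weight_prepend(2)[OF w, of \<beta>] permsD(3)[OF w]
    by (simp add: Pi4_gf_def Pi4_child_threshold_def power2_eq_square)
  finally have "1 + fps_X * (\<Sum>v=1..\<beta>. ?H v) = rl_weight w \<beta> + fps_X * Cat\<^sup>2 * rl_weight w \<beta>"
    using rl_weight_sum[OF \<beta>(1), of w] by (simp add: distrib_left mult.assoc add.assoc[symmetric])
  also have "\<dots> = (1 + fps_X * Cat\<^sup>2) * rl_weight w \<beta>"
    by (simp add: distrib_right)
  also have "\<dots> = Cat * rl_weight w \<beta>"
    by (simp only: Cat_eq[symmetric])
  finally show ?thesis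
    using \<beta>(2) permsD(3)[OF w] by (simp add: Pi4_gf_def)
qed

lemma Pi4_gf_full:
  assumes w: "w \<in> perms n" and n: "0 < n"
  shows "Pi4_gf w (Suc n) =
    1 + fps_X * (\<Sum>v=1..Suc n. Pi4_gf (prepend v w) (Pi4_child_threshold w (Suc n) v))"
    (is "_ = 1 + fps_X * (\<Sum>v=1..Suc n. ?H v)")
proof -
  have "(\<Sum>v=1..Suc n. ?H v) = (\<Sum>v\<in>{1..<n}. ?H v) + ?H n + ?H (Suc n)"
    using n by (simp add: atLeastLessThanSuc_atLeastAtMost[symmetric])
  also have "(\<Sum>v\<in>{1..<n}. ?H v) =
      (\<Sum>v\<in>{1..<n}. Cat\<^sup>2 * rl_weight w v * (if rl_max w v then inv_2_Cat else 1))"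
    by (intro sum.cong refl Pi4_gf_child_below[OF w]) auto
  also have "?H n = Cat * delta * rl_weight w n * Cat"
    using rl_weight_prepend(2)[OF w, of n] n rl_max_length[OF w] permsD(3)[OF w]
    by (simp add: Pi4_gf_def Pi4_child_threshold_def mult.assoc)
  also have "?H (Suc n) = Cat * delta * rl_weight w n * inv_2_Cat"
    using rl_weight_prepend(1)[OF w, of "Suc n"] n rl_max_length[OF w] permsD(3)[OF w]
    by (simp add: Pi4_gf_def Pi4_child_threshold_def rl_weight_Suc mult.assoc)
  finally have "1 + fps_X * (\<Sum>v=1..Suc n. ?H v) = rl_weight w n +
      fps_X * (Cat * delta * rl_weight w n * Cat + Cat * delta * rl_weight w n * inv_2_Cat)"
    using rl_weight_sum[of n w] n by (simp add: distrib_left add.assoc[symmetric])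
  also have "\<dots> = (1 + fps_X * (Cat * delta * (Cat + inv_2_Cat))) * rl_weight w n"
    by (simp add: algebra_simps)
  also have "\<dots> = Cat * delta * rl_weight w n"
    by (simp only: Cat_delta_eq[symmetric])
  finally show ?thesis
    using n permsD(3)[OF w] by (auto simp: Pi4_gf_def)
qed

lemma Pi4_gf_step:
  assumes w: "w \<in> perms n" and \<beta>: "1 \<le> \<beta>" "\<beta> \<le> Suc n"
  shows "Pi4_gf w \<beta> = 1 + fps_X * (\<Sum>v=1..\<beta>. Pi4_gf (prepend v w) (Pi4_child_threshold w \<beta> v))"
proof -
  consider (partial) "\<beta> \<le> n" | (full) "\<beta> = Suc n" "0 < n" | (root) "\<beta> = 1" "w = []"
    using \<beta> permsD(3)[OF w] by fastforce
  then show ?thesis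
  proof cases
    case root
    then show ?thesis
      using Pi4_gf_root by (simp add: Pi4_gf_def[of "[]"])
  qed (use \<beta> Pi4_gf_partial[OF w] Pi4_gf_full[OF w] in auto)
qed

lemma avoiders_gf_Pi4: "avoiders_gf Pi4 = common_gf"
proof -
  define R where
    "R w G \<longleftrightarrow> (\<exists>\<beta>. down_threshold (length w) (no_123_132_below w) \<beta> \<and> G = Pi4_gf w \<beta>)" for w G
  have "avoiders_gf (rev ` Pi4) = common_gf"
  proof (rule avoiders_gf_eqI[where R = R])
    show "[] \<notin> rev ` Pi4"
      using rev_Pi4_length by force
    show "R [] common_gf"
      unfolding R_def
      by (intro exI[of _ 1]) (simp add: down_threshold_def no_123_132_below_def Pi4_gf_def)
    fix n w G assume w: "w \<in> perms n" and "R w G"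
    then obtain \<beta> where \<beta>: "down_threshold n (no_123_132_below w) \<beta>" and G: "G = Pi4_gf w \<beta>"
      using permsD(3)[OF w] by (auto simp: R_def)
    let ?H = "\<lambda>v. Pi4_gf (prepend v w) (Pi4_child_threshold w \<beta> v)"
    have "G = 1 + fps_X * sum ?H {1..\<beta>}"
      using Pi4_gf_step[OF w] \<beta> by (simp add: G down_threshold_def)
    moreover have "children_sum R w {1..\<beta>} (sum ?H {1..\<beta>})"
      using no_123_132_below_prepend_threshold[OF w \<beta>] permsD(3)[OF w]
      by (intro children_sumI) (auto simp: R_def)
    ultimately show "\<exists>s. G = 1 + fps_X * s \<and> children_sum R w (sites (rev ` Pi4) w) s"
      unfolding sites_rev_Pi4[OF w \<beta>] by blast
  qed
  then show ?thesis
    by (simp only: avoiders_gf_rev)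
qed

section \<open>The class of \<open>\<Pi>\<^sub>5\<close>\<close>

definition no_123_below :: "nat list \<Rightarrow> nat \<Rightarrow> bool" where
  "no_123_below w u \<longleftrightarrow> (\<forall>x y z. before w x y \<longrightarrow> before w y z \<longrightarrow> x < y \<longrightarrow> y < z \<longrightarrow> u \<le> y)"

abbreviation no_312_above :: "nat list \<Rightarrow> nat \<Rightarrow> bool" where
  "no_312_above \<equiv> avoids_above (\<lambda>x y z. y < z \<and> z < x)"

definition descending_between :: "nat list \<Rightarrow> nat \<Rightarrow> nat \<Rightarrow> bool" where
  "descending_between w u v \<longleftrightarrow> (\<forall>y z. before w y z \<longrightarrow> u \<le> y \<longrightarrow> y < z \<longrightarrow> \<not> z < v)"

lemma matches_rev_Pi5:
  "matches (rev ` Pi5) [v, bump v x, bump v y, bump v z] \<longleftrightarrow>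
    x < y \<and> y < z \<and> y < v \<or> v \<le> x \<and> v \<le> y \<and> v \<le> z \<and> y < z \<and> z < x"
  unfolding matches_def Pi5_def by (simp add: order_isomorphic_patterns del: One_nat_def) linarith

lemma rev_Pi5_length: "\<forall>\<tau>\<in>rev ` Pi5. length \<tau> = 4"
  by (simp add: Pi5_def)

lemma sites_rev_Pi5:
  assumes w: "w \<in> perms n" and l: "up_threshold n (no_312_above w) l"
    and \<beta>: "down_threshold n (no_123_below w) \<beta>"
  shows "sites (rev ` Pi5) w = {l..\<beta>}"
proof -
  have "sites (rev ` Pi5) w = {v \<in> {1..Suc n}. no_123_below w v \<and> no_312_above w v}"
    unfolding sites_length_4[OF rev_Pi5_length permsD(1)[OF w]] matches_rev_Pi5
      no_123_below_def avoids_above_def permsD(3)[OF w] not_le[symmetric]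
    by blast
  then show ?thesis
    using l \<beta> by (auto simp: down_threshold_def up_threshold_def)
qed

lemma no_123_below_prepend:
  "no_123_below (prepend v w) u \<longleftrightarrow> no_123_below w (unbump v u) \<and>
    (\<forall>y. (\<exists>z. before w y z \<and> v \<le> y \<and> y < z) \<longrightarrow> unbump v u \<le> y)"
  unfolding no_123_below_def all_before_before_prepend le_bump_iff by simp blast

lemma no_123_below_prepend_threshold:
  assumes w: "w \<in> perms n" and \<beta>: "down_threshold n (no_123_below w) \<beta>"
    and v: "1 \<le> v" "v \<le> m" "m \<le> \<beta>"
    and run: "\<And>y. v \<le> y \<Longrightarrow> y < m \<Longrightarrow> rl_max w y" and stop: "m = \<beta> \<or> \<not> rl_max w m"
  shows "down_threshold (Suc n) (no_123_below (prepend v w)) (Suc m)"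
proof (rule down_threshold_prepend[OF \<beta> v no_123_below_prepend])
  fix y assume "\<exists>z. before w y z \<and> v \<le> y \<and> y < z"
  then have "v \<le> y" "\<not> rl_max w y"
    using not_rl_max_iff[OF permsD(1)[OF w]] by blast+
  then show "m \<le> y"
    using run not_le by blast
next
  show "m = \<beta> \<or> (\<exists>z. before w m z \<and> v \<le> m \<and> m < z)"
    using stop v(2) not_rl_max_iff[OF permsD(1)[OF w]] by blast
qed

lemma no_312_above_prepend:
  "no_312_above (prepend v w) u \<longleftrightarrow>
    no_312_above w (unbump v u) \<and> (u \<le> v \<longrightarrow> descending_between w u v)"
proof -
  have "no_312_above (prepend v w) u \<longleftrightarrow> no_312_above w (unbump v u) \<and> (u \<le> v \<longrightarrow>
    (\<forall>b c. before w b c \<longrightarrow> u \<le> b \<longrightarrow> u \<le> c \<longrightarrow> \<not> (bump v b < bump v c \<and> bump v c < v)))"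
    by (rule avoids_above_prepend) simp
  then show ?thesis
    unfolding descending_between_def bump_less_iff bump_less_self_iff
    by (meson less_imp_le order_trans)
qed

lemma descending_between_mono:
  "descending_between w s v \<Longrightarrow> s \<le> t \<Longrightarrow> descending_between w t v"
  unfolding descending_between_def by (meson order_trans)

lemma no_312_above_prepend_threshold:
  assumes l: "up_threshold n (no_312_above w) l" and v: "l \<le> m" "m \<le> v" "v \<le> Suc n"
    and desc: "descending_between w m v" and stop: "m = l \<or> \<not> descending_between w (m - 1) v"
  shows "up_threshold (Suc n) (no_312_above (prepend v w)) m"
proof (rule up_threshold_prepend[OF l _ v(3,1) _ no_312_above_prepend])
  fix u assume "l \<le> u"
  have "u \<le> m - 1" "m \<noteq> l" if "\<not> m \<le> u"
    using that \<open>l \<le> u\<close> by auto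
  then show "descending_between w u v \<longleftrightarrow> m \<le> u"
    using desc stop descending_between_mono by blast
qed (use v in simp_all)

lemma descending_betweenI:
  assumes w: "distinct w" and adjacent: "\<And>y. u \<le> y \<Longrightarrow> Suc y < v \<Longrightarrow> before w (Suc y) y"
  shows "descending_between w u v"
proof -
  have "before w z y" if "Suc y \<le> z" "u \<le> y" "z < v" for y z
    using that
  proof (induction z rule: dec_induct)
    case base
    then show ?case
      using adjacent by simp
  next
    case (step z)
    then have "before w (Suc z) z" "before w z y"
      using adjacent[of z] by auto
    then show ?case
      using before_trans[OF w] by blast
  qed
  then show ?thesis
    unfolding descending_between_def using before_asym[OF w] Suc_leI by blast
qed

text \<open>The admissible values are \<open>l, \<dots>, l + a + b + c\<close>; those among them that are below the last one
  are \<open>a\<close> right-to-left maxima, followed by \<open>b\<close> other values, followed by \<open>c\<close> right-to-left maxima.\<close>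

definition window :: "nat list \<Rightarrow> nat \<Rightarrow> nat \<Rightarrow> nat \<Rightarrow> nat \<Rightarrow> bool" where
  "window w l a b c \<longleftrightarrow>
     up_threshold (length w) (no_312_above w) l \<and>
     down_threshold (length w) (no_123_below w) (l + a + b + c) \<and>
     (\<forall>y\<in>{l..<l + a}. rl_max w y) \<and>
     (\<forall>y\<in>{l + a..<l + a + b}. \<not> rl_max w y) \<and>
     (\<forall>y\<in>{l + a + b..<l + a + b + c}. rl_max w y) \<and>
     (b = 0 \<longrightarrow> c = 0 \<and> l + a = Suc (length w))"

context
  fixes w n l a b c
  assumes w: "w \<in> perms n" and window: "window w l a b c"
begin

lemma window_up: "up_threshold n (no_312_above w) l"
  and window_down: "down_threshold n (no_123_below w) (l + a + b + c)"
  and window_left: "l \<le> y \<Longrightarrow> y < l + a \<Longrightarrow> rl_max w y"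
  and window_middle: "l + a \<le> y \<Longrightarrow> y < l + a + b \<Longrightarrow> \<not> rl_max w y"
  and window_right: "l + a + b \<le> y \<Longrightarrow> y < l + a + b + c \<Longrightarrow> rl_max w y"
  and window_no_middle: "b = 0 \<Longrightarrow> c = 0 \<and> l + a = Suc n"
  using window permsD(3)[OF w] by (auto simp: window_def)

lemma window_bounds: "1 \<le> l" "l + a + b + c \<le> Suc n"
  using window_up window_down by (auto simp: up_threshold_def down_threshold_def)

lemma window_full: "l + a + b + c = Suc n \<Longrightarrow> 0 < b \<Longrightarrow> 0 < c"
  using window_middle[of n] rl_max_length[OF w] by (cases c) auto

lemma window_adjacent:
  assumes y: "l \<le> y" "Suc y < l + a + b + c" "rl_max w y \<or> \<not> rl_max w (Suc y)"
  shows "before w (Suc y) y"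
proof (rule ccontr)
  assume "\<not> before w (Suc y) y"
  moreover have "y \<in> set w" "Suc y \<in> set w"
    using y window_bounds permsD(2)[OF w] by auto
  ultimately have ascent: "before w y (Suc y)"
    using before_total[of y w "Suc y"] by auto
  then have "\<not> rl_max w y"
    unfolding rl_max_def by auto
  then obtain z where "before w (Suc y) z" "Suc y < z"
    using y(3) not_rl_max_iff[OF permsD(1)[OF w]] by blast
  moreover have "no_123_below w (l + a + b + c)"
    using window_down by (auto simp: down_threshold_def)
  ultimately have "l + a + b + c \<le> Suc y"
    using ascent unfolding no_123_below_def by blast
  then show False
    using y(2) by simp
qed

lemma window_descending_left: "v \<le> l + a + b \<Longrightarrow> descending_between w l v"
proof (rule descending_betweenI[OF permsD(1)[OF w]])
  fix y assume "v \<le> l + a + b" "l \<le> y" "Suc y < v"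
  then show "before w (Suc y) y"
    using window_left[of y] window_middle[of "Suc y"] by (intro window_adjacent) force+
qed

lemma window_descending_right: "v \<le> l + a + b + c \<Longrightarrow> descending_between w (l + a + b) v"
proof (rule descending_betweenI[OF permsD(1)[OF w]])
  fix y assume "v \<le> l + a + b + c" "l + a + b \<le> y" "Suc y < v"
  then show "before w (Suc y) y"
    using window_right[of y] by (intro window_adjacent) auto
qed

lemma window_not_descending:
  assumes "0 < b" "l + a + b < v" "v \<le> l + a + b + c"
  shows "\<not> descending_between w (l + a + b - 1) v"
proof -
  define y where "y = l + a + b - 1"
  have y: "Suc y = l + a + b"
    using assms(1) by (simp add: y_def)
  then have "\<not> rl_max w y"
    using window_middle[of y] assms(1) by simp
  then obtain z where z: "before w y z" "y < z"
    using not_rl_max_iff[OF permsD(1)[OF w]] by blast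
  have "before w y (Suc y)"
  proof (rule ccontr)
    assume "\<not> before w y (Suc y)"
    moreover have "y \<in> set w" "Suc y \<in> set w"
      using before_in_set[OF z(1)] y assms window_bounds permsD(2)[OF w] by auto
    ultimately have "before w (Suc y) y"
      using before_total[of y w "Suc y"] by auto
    then have "before w (Suc y) z"
      using before_trans[OF permsD(1)[OF w]] z(1) by blast
    moreover have "rl_max w (Suc y)"
      using window_right[of "Suc y"] y assms by simp
    ultimately show False
      using z(2) by (auto simp: rl_max_def)
  qed
  then show ?thesis
    unfolding y_def[symmetric] descending_between_def using y assms(2) by force
qed

lemma window_prepend_up_left:
  "l \<le> v \<Longrightarrow> v \<le> l + a + b \<Longrightarrow> up_threshold (Suc n) (no_312_above (prepend v w)) l"
  using window_bounds window_descending_left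
  by (intro no_312_above_prepend_threshold[OF window_up]) auto

lemma window_prepend_up_right:
  "0 < b \<Longrightarrow> l + a + b < v \<Longrightarrow> v \<le> l + a + b + c \<Longrightarrow>
    up_threshold (Suc n) (no_312_above (prepend v w)) (l + a + b)"
  using window_bounds window_descending_right window_not_descending
  by (intro no_312_above_prepend_threshold[OF window_up]) auto

lemma window_prepend_down:
  assumes "l \<le> v" "v \<le> m" "m \<le> l + a + b + c" "m' = Suc m"
    and "\<And>y. v \<le> y \<Longrightarrow> y < m \<Longrightarrow> rl_max w y" "m = l + a + b + c \<or> \<not> rl_max w m"
  shows "down_threshold (Suc n) (no_123_below (prepend v w)) m'"
  unfolding assms(4) using assms window_bounds
  by (intro no_123_below_prepend_threshold[OF w window_down]) auto

lemma rl_max_prepend_window: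
  "l \<le> v \<Longrightarrow> v \<le> l + a + b + c \<Longrightarrow> rl_max (prepend v w) y \<longleftrightarrow>
    (if y < v then rl_max w y else if y = v then v = Suc n else rl_max w (y - 1))"
  using window_bounds by (intro rl_max_prepend[OF w]) auto

lemma window_child_left:
  assumes "0 < b \<or> p < a" "p \<le> a"
  shows "window (prepend (l + p) w) l p 1 (a - p)"
  using assms window_bounds window_prepend_up_left[of "l + p"]
    window_prepend_down[of "l + p" "l + a"] rl_max_prepend_window[of "l + p"]
    window_left window_middle[of "l + a"] window_no_middle
  unfolding window_def length_prepend permsD(3)[OF w]
  by auto

lemma window_child_all_left:
  assumes "b = 0"
  shows "window (prepend (l + a) w) l (Suc a) 0 0"
  using assms window_bounds window_prepend_up_left[of "l + a"]
    window_prepend_down[of "l + a" "l + a"] rl_max_prepend_window[of "l + a"]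
    window_left window_no_middle
  unfolding window_def length_prepend permsD(3)[OF w]
  by auto

lemma window_child_middle:
  assumes "1 \<le> t" "t < b"
  shows "window (prepend (l + a + t) w) l a (Suc t) 0"
  using assms window_bounds window_prepend_up_left[of "l + a + t"]
    window_prepend_down[of "l + a + t" "l + a + t"] rl_max_prepend_window[of "l + a + t"]
    window_left window_middle
  unfolding window_def length_prepend permsD(3)[OF w]
  by auto

lemma window_child_middle_end:
  assumes "0 < b"
  shows "window (prepend (l + a + b) w) l a (Suc b) c"
  using assms window_bounds window_prepend_up_left[of "l + a + b"]
    window_prepend_down[of "l + a + b" "l + a + b + c"] rl_max_prepend_window[of "l + a + b"]
    window_left window_middle window_right window_full
  unfolding window_def length_prepend permsD(3)[OF w]
  by auto

lemma window_child_right: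
  assumes "0 < b" "1 \<le> t" "t \<le> c" "l + a + b + t \<le> n"
  shows "window (prepend (l + a + b + t) w) (l + a + b) t 1 (c - t)"
  using assms window_bounds window_prepend_up_right[of "l + a + b + t"]
    window_prepend_down[of "l + a + b + t" "l + a + b + c" "l + a + b + t + 1 + (c - t)"]
    rl_max_prepend_window[of "l + a + b + t"] window_right
  unfolding window_def length_prepend permsD(3)[OF w]
  by auto

lemma window_child_right_end:
  assumes "0 < b" "l + a + b + c = Suc n"
  shows "window (prepend (l + a + b + c) w) (l + a + b) (Suc c) 0 0"
  using assms window_bounds window_prepend_up_right[of "l + a + b + c"]
    window_prepend_down[of "l + a + b + c" "l + a + b + c"]
    rl_max_prepend_window[of "l + a + b + c"] window_right window_full
  unfolding window_def length_prepend permsD(3)[OF w]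
  by auto

end

definition inv_Cat_1 :: "real fps" where
  "inv_Cat_1 = inverse (Cat + 1)"

lemma inv_Cat_1: "inv_Cat_1 * (Cat + 1) = 1"
  unfolding inv_Cat_1_def by (rule inverse_mult_eq_1) simp

text \<open>The series \<open>e\<close>, \<open>\<rho>\<close> and \<open>\<sigma>\<close> solve the linear recurrences \<open>gf_e_eq\<close>, \<open>gf_rho_Suc\<close> and
  \<open>gf_sigma_Suc_Suc\<close>.\<close>

definition gf_e :: "nat \<Rightarrow> real fps" where
  "gf_e a = Cat\<^sup>2 * (1 + Cat * (Cat ^ a)\<^sup>2) * inv_Cat_1"

definition gf_rho :: "nat \<Rightarrow> real fps" where
  "gf_rho c = Cat\<^sup>2 * ((Cat ^ c)\<^sup>2 - 1) * inv_Cat_1"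

definition gf_sigma :: "nat \<Rightarrow> real fps" where
  "gf_sigma c = inv_Cat_1 * inv_quad * Cat * (Cat ^ c)\<^sup>2 - Cat\<^sup>2 * inv_Cat_1 -
     (Cat - 1)\<^sup>2 * inv_quad * Cat ^ c"

lemma gf_rho_0 [simp]: "gf_rho 0 = 0"
  by (simp add: gf_rho_def)

lemma gf_e_eq: "gf_e a = Cat * (Cat + gf_rho a)"
  unfolding gf_e_def gf_rho_def using inv_Cat_1 by algebra

lemma gf_e_0: "gf_e 0 = Cat\<^sup>2"
  by (simp add: gf_e_eq power2_eq_square)

lemma gf_rho_Suc: "gf_rho (Suc a) = gf_rho a + fps_X * (gf_e (Suc a) + gf_rho (Suc a))"
proof -
  have "Cat\<^sup>2 * ((Cat * P)\<^sup>2 - 1) * inv_Cat_1 = Cat\<^sup>2 * (P\<^sup>2 - 1) * inv_Cat_1 +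
      fps_X * (Cat\<^sup>2 * (1 + Cat * (Cat * P)\<^sup>2) * inv_Cat_1 + Cat\<^sup>2 * ((Cat * P)\<^sup>2 - 1) * inv_Cat_1)"
    for P
    using inv_Cat_1 Cat_eq by algebra
  from this[of "Cat ^ a"] show ?thesis
    by (simp only: gf_rho_def gf_e_def power_Suc)
qed

lemma gf_sigma_Suc_Suc:
  "fps_X * gf_sigma (Suc (Suc c)) = gf_sigma (Suc c) - gf_sigma c - fps_X * gf_e c"
proof -
  define s where "s P = inv_Cat_1 * inv_quad * Cat * P\<^sup>2 - Cat\<^sup>2 * inv_Cat_1 -
    (Cat - 1)\<^sup>2 * inv_quad * P" for P
  have "fps_X * s (Cat * (Cat * P)) =
      s (Cat * P) - s P - fps_X * (Cat\<^sup>2 * (1 + Cat * P\<^sup>2) * inv_Cat_1)" for P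
    unfolding s_def using inv_Cat_1 inv_quad Cat_eq by algebra
  from this[of "Cat ^ c"] show ?thesis
    by (simp only: gf_sigma_def gf_e_def power_Suc s_def)
qed

lemma inv_Cat_1_inv_quad: "inv_Cat_1 * inv_quad * Cat = inv_Cat_1 + (Cat - 1) * inv_quad"
  using inv_Cat_1 inv_quad by algebra

lemma Cat_gf_sigma_0: "Cat + gf_sigma 0 = common_gf"
proof -
  have "Cat\<^sup>2 * inv_Cat_1 = Cat - 1 + inv_Cat_1"
    using inv_Cat_1 by algebra
  then show ?thesis
    unfolding gf_sigma_def common_gf_def inv_Cat_1_inv_quad power_0 power_one mult_1_right
    by algebra
qed

lemma Cat_gf_sigma_1: "Cat + gf_sigma 1 = Cat * delta"
  unfolding gf_sigma_def inv_Cat_1_inv_quad power_one_right delta_def using inv_quad by algebra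

definition window_tail :: "bool \<Rightarrow> nat \<Rightarrow> real fps" where
  "window_tail full c = (if full then gf_sigma c else gf_rho c)"

text \<open>A window is full if it extends to \<open>n + 1\<close>: no value is too large to be admissible.\<close>

definition window_gf :: "bool \<Rightarrow> nat \<Rightarrow> nat \<Rightarrow> nat \<Rightarrow> real fps" where
  "window_gf full a b c =
     (if b = 0 then Cat + gf_sigma a else Cat ^ (b - 1) * gf_e a + window_tail full c)"

lemma window_tail_rho_sum:
  "fps_X * (\<Sum>t<c. window_gf False (Suc t) 1 (c - Suc t)) = gf_rho c - fps_X * gf_rho c"
proof -
  have "fps_X * (\<Sum>t<c. gf_e (Suc t) + gf_rho t) = gf_rho c - fps_X * gf_rho c"
  proof (induction c)
    case (Suc c)
    have "T + fps_X * (e + r) = r' - fps_X * r'"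
      if "T = r - fps_X * r" "r' = r + fps_X * (e + r')" for T e r r' :: "real fps"
      using that by algebra
    from this[OF Suc gf_rho_Suc] show ?case
      by (simp add: distrib_left)
  qed simp
  then show ?thesis
    by (simp add: window_gf_def window_tail_def sum.distrib sum.nat_diff_reindex)
qed

lemma window_tail_sigma_sum:
  "fps_X * ((\<Sum>t<c. window_gf True (Suc t) 1 (Suc c - Suc t)) + window_gf True (Suc (Suc c)) 0 0) =
    gf_sigma (Suc c) - fps_X * gf_sigma (Suc c)"
proof -
  have "fps_X * ((\<Sum>t<c. gf_e (Suc t) + gf_sigma (Suc t)) + (Cat + gf_sigma (Suc (Suc c)))) =
    gf_sigma (Suc c) - fps_X * gf_sigma (Suc c)"
  proof (induction c)
    case 0
    have "fps_X * (Cat + s'') = s' - fps_X * s'"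
      if "fps_X * s'' = s' - s - fps_X * Cat\<^sup>2" "Cat + s = 1 + fps_X * (Cat + s')" for s s' s''
      using that Cat_eq by algebra
    moreover have "Cat + gf_sigma 0 = 1 + fps_X * (Cat + gf_sigma 1)"
      by (simp only: Cat_gf_sigma_0 Cat_gf_sigma_1 common_gf_eq_delta)
    ultimately show ?case
      using gf_sigma_Suc_Suc[of 0] by (simp add: gf_e_0)
  next
    case (Suc c)
    have "fps_X * ((T + (e + s)) + (Cat + s'')) = s' - fps_X * s'"
      if "fps_X * (T + (Cat + s')) = s - fps_X * s" "fps_X * s'' = s' - s - fps_X * e"
      for T e s s' s''
      using that by algebra
    from this[OF Suc gf_sigma_Suc_Suc] show ?case
      by simp
  qed
  moreover have "(\<Sum>t<c. gf_sigma (c - t)) = (\<Sum>t<c. gf_sigma (Suc t))"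
    using sum.nat_diff_reindex[of "\<lambda>t. gf_sigma (Suc t)" c] by (simp add: Suc_diff_Suc)
  ultimately show ?thesis
    by (simp add: window_gf_def window_tail_def sum.distrib)
qed

lemma window_gf_no_middle:
  "window_gf True a 0 0 =
    1 + fps_X * ((\<Sum>p<a. window_gf True p 1 (a - p)) + window_gf True (Suc a) 0 0)"
proof (cases a)
  case 0
  then show ?thesis
    using Cat_gf_sigma_0 Cat_gf_sigma_1 by (simp add: window_gf_def common_gf_eq_delta)
next
  case (Suc a')
  have "Cat + s = 1 + fps_X * ((Cat\<^sup>2 + s + T) + u)"
    if "fps_X * (T + u) = s - fps_X * s" for s T u
    using that Cat_eq by algebra
  from this[OF window_tail_sigma_sum[of a']] show ?thesis
    unfolding Suc sum.lessThan_Suc_shift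
    by (simp add: window_gf_def[of _ 0] window_gf_def[of _ _ 0] window_tail_def gf_e_0)
qed

lemma window_gf_left_sum:
  "fps_X * (\<Sum>p<Suc a. window_gf False p 1 (a - p)) = fps_X * Cat\<^sup>2 + gf_rho a"
  using window_tail_rho_sum[of a] unfolding sum.lessThan_Suc_shift
  by (simp add: window_gf_def[of _ 0] window_tail_def gf_e_0 distrib_left)

lemma window_gf_middle:
  assumes T: "fps_X * T = window_tail full c - fps_X * window_tail full c"
  shows "window_gf full a (Suc b) c = 1 + fps_X * ((\<Sum>p<Suc a. window_gf False p 1 (a - p)) +
    (\<Sum>t<b. window_gf False a (Suc (Suc t)) 0) + window_gf full a (Suc (Suc b)) c + T)"
proof -
  define S where "S = (\<Sum>t<Suc b. Cat ^ t)"
  have "(\<Sum>t<b. window_gf False a (Suc (Suc t)) 0) + window_gf full a (Suc (Suc b)) c =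
      Cat * S * gf_e a + window_tail full c"
    by (simp add: window_gf_def window_tail_def S_def sum_distrib_left sum_distrib_right
        distrib_left distrib_right)
  moreover have "1 + fps_X * (A + (Cat * S * (Cat * (Cat + r)) + s) + T) = Q * (Cat + r) + s"
    if "fps_X * A = fps_X * Cat\<^sup>2 + r" "fps_X * Cat\<^sup>2 * S = Q - 1" "fps_X * T = s - fps_X * s"
    for A r Q s
    using that Cat_eq by algebra
  from this[OF window_gf_left_sum Cat_geometric_sum[of "Suc b", folded S_def] T]
  have "1 + fps_X * ((\<Sum>p<Suc a. window_gf False p 1 (a - p)) +
      (Cat * S * gf_e a + window_tail full c) + T) = window_gf full a (Suc b) c"
    by (simp add: gf_e_eq window_gf_def mult.assoc)
  ultimately show ?thesis
    by (simp only: add.assoc)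
qed

definition has_window_gf :: "nat list \<Rightarrow> real fps \<Rightarrow> bool" where
  "has_window_gf w G \<longleftrightarrow> (\<exists>l a b c. window w l a b c \<and>
     G = window_gf (l + a + b + c = Suc (length w)) a b c)"

lemma has_window_gfI:
  "window w l a b c \<Longrightarrow> full \<longleftrightarrow> l + a + b + c = Suc (length w) \<Longrightarrow>
    has_window_gf w (window_gf full a b c)"
  unfolding has_window_gf_def by blast

lemma children_sum_no_middle:
  assumes w: "w \<in> perms n" and window: "window w l a 0 c"
  shows "children_sum has_window_gf w {l..<Suc (l + a)}
    ((\<Sum>p<a. window_gf True p 1 (a - p)) + window_gf True (Suc a) 0 0)"
proof (rule children_sum_snoc[OF children_sum_interval])
  have full: "l + a = Suc n"
    using window_no_middle[OF w window] by simp
  show "has_window_gf (prepend (l + p) w) (window_gf True p 1 (a - p))" if "p < a" for p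
    by (rule has_window_gfI[OF window_child_left[OF w window]])
      (use that full permsD(3)[OF w] in auto)
  show "has_window_gf (prepend (l + a) w) (window_gf True (Suc a) 0 0)"
    by (rule has_window_gfI[OF window_child_all_left[OF w window]])
      (use full permsD(3)[OF w] in auto)
qed simp

lemma children_sum_left_middle:
  assumes w: "w \<in> perms n" and window: "window w l a (Suc b) c"
    and full: "full \<longleftrightarrow> l + a + Suc b + c = Suc n"
  shows "children_sum has_window_gf w {l..<Suc (l + Suc a + b)}
    ((\<Sum>p<Suc a. window_gf False p 1 (a - p)) + (\<Sum>t<b. window_gf False a (Suc (Suc t)) 0) +
      window_gf full a (Suc (Suc b)) c)"
proof (rule children_sum_snoc[OF
      children_sum_append[OF children_sum_interval children_sum_interval]])
  note bounds = window_bounds[OF w window]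
  show "has_window_gf (prepend (l + p) w) (window_gf False p 1 (a - p))" if "p < Suc a" for p
    by (rule has_window_gfI[OF window_child_left[OF w window]])
      (use that bounds permsD(3)[OF w] in auto)
  show "has_window_gf (prepend (l + Suc a + t) w) (window_gf False a (Suc (Suc t)) 0)"
    if "t < b" for t
    using has_window_gfI[OF window_child_middle[OF w window, of "Suc t"], of False]
      that bounds permsD(3)[OF w] by simp
  show "has_window_gf (prepend (l + Suc a + b) w)
      (window_gf full a (Suc (Suc b)) c)"
    using has_window_gfI[OF window_child_middle_end[OF w window]] full permsD(3)[OF w] by simp
qed auto

lemma children_sum_right:
  assumes w: "w \<in> perms n" and window: "window w l a (Suc b) c"
    and d: "d \<le> c" "l + a + Suc b + d \<le> n" and full: "full \<longleftrightarrow> l + a + Suc b + c = Suc n"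
  shows "children_sum has_window_gf w {Suc (l + Suc a + b)..<Suc (l + Suc a + b) + d}
    (\<Sum>t<d. window_gf full (Suc t) 1 (c - Suc t))"
proof (rule children_sum_interval)
  fix t assume t: "t < d"
  have "has_window_gf (prepend (l + a + Suc b + Suc t) w) (window_gf full (Suc t) 1 (c - Suc t))"
    by (rule has_window_gfI[OF window_child_right[OF w window]])
      (use t d full permsD(3)[OF w] in auto)
  then show "has_window_gf (prepend (Suc (l + Suc a + b) + t) w)
      (window_gf full (Suc t) 1 (c - Suc t))"
    by simp
qed

lemma children_sum_right_tail:
  assumes w: "w \<in> perms n" and window: "window w l a (Suc b) c"
    and full: "full \<longleftrightarrow> l + a + Suc b + c = Suc n"
  shows "\<exists>T. fps_X * T = window_tail full c - fps_X * window_tail full c \<and>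
    children_sum has_window_gf w {Suc (l + Suc a + b)..<Suc (l + Suc a + b) + c} T"
proof (cases full)
  case True
  then obtain c' where c: "c = Suc c'"
    using window_full[OF w window] full by (cases c) auto
  have "children_sum has_window_gf w {Suc (l + Suc a + b)..<Suc (Suc (l + Suc a + b) + c')}
    ((\<Sum>t<c'. window_gf True (Suc t) 1 (Suc c' - Suc t)) + window_gf True (Suc (Suc c')) 0 0)"
  proof (rule children_sum_snoc[OF children_sum_right[OF w window[unfolded c]]])
    have "has_window_gf (prepend (l + a + Suc b + c) w) (window_gf True (Suc c) 0 0)"
      by (rule has_window_gfI[OF window_child_right_end[OF w window]])
        (use True full permsD(3)[OF w] in auto)
    then show "has_window_gf (prepend (Suc (l + Suc a + b) + c') w)
        (window_gf True (Suc (Suc c')) 0 0)"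
      by (simp add: c)
  qed (use True full c in auto)
  then show ?thesis
    using window_tail_sigma_sum[of c'] True by (auto simp: c window_tail_def)
next
  case False
  then have "children_sum has_window_gf w {Suc (l + Suc a + b)..<Suc (l + Suc a + b) + c}
    (\<Sum>t<c. window_gf False (Suc t) 1 (c - Suc t))"
    using window_bounds[OF w window] full by (intro children_sum_right[OF w window]) auto
  then show ?thesis
    using window_tail_rho_sum[of c] False by (auto simp: window_tail_def)
qed

lemma window_gf_step_middle:
  assumes w: "w \<in> perms n" and window: "window w l a (Suc b) c"
    and full: "full \<longleftrightarrow> l + a + Suc b + c = Suc n"
  shows "\<exists>s. window_gf full a (Suc b) c = 1 + fps_X * s \<and>
    children_sum has_window_gf w {l..<Suc (l + Suc a + b) + c} s"
proof -
  obtain T where T: "fps_X * T = window_tail full c - fps_X * window_tail full c"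
    and right: "children_sum has_window_gf w {Suc (l + Suc a + b)..<Suc (l + Suc a + b) + c} T"
    using children_sum_right_tail[OF assms] by (elim exE conjE)
  have "children_sum has_window_gf w {l..<Suc (l + Suc a + b) + c}
    ((\<Sum>p<Suc a. window_gf False p 1 (a - p)) + (\<Sum>t<b. window_gf False a (Suc (Suc t)) 0) +
      window_gf full a (Suc (Suc b)) c + T)"
    by (rule children_sum_append[OF children_sum_left_middle[OF assms] right]) simp_all
  with window_gf_middle[OF T] show ?thesis
    by (intro exI conjI)
qed

lemma window_gf_step:
  assumes w: "w \<in> perms n" and "has_window_gf w G"
  shows "\<exists>s. G = 1 + fps_X * s \<and> children_sum has_window_gf w (sites (rev ` Pi5) w) s"
proof -
  obtain l a b c where window: "window w l a b c"
    and G: "G = window_gf (l + a + b + c = Suc n) a b c"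
    using assms(2) unfolding has_window_gf_def permsD(3)[OF w] by blast
  have sites: "sites (rev ` Pi5) w = {l..<Suc (l + a + b + c)}"
    unfolding atLeastLessThanSuc_atLeastAtMost
    by (rule sites_rev_Pi5[OF w window_up[OF w window] window_down[OF w window]])
  show ?thesis
  proof (cases b)
    case 0
    then have "c = 0" "l + a = Suc n"
      using window_no_middle[OF w window] by simp_all
    then show ?thesis
      using children_sum_no_middle[OF w window[unfolded 0]] window_gf_no_middle[of a]
      unfolding sites G 0 by auto
  next
    case (Suc b')
    have "sites (rev ` Pi5) w = {l..<Suc (l + Suc a + b') + c}"
      unfolding sites Suc by simp
    then show ?thesis
      using window_gf_step_middle[OF w window[unfolded Suc] refl] unfolding G Suc by simp
  qed
qed

lemma avoiders_gf_Pi5: "avoiders_gf Pi5 = common_gf"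
proof -
  have "avoiders_gf (rev ` Pi5) = common_gf"
  proof (rule avoiders_gf_eqI[OF _ _ window_gf_step])
    show "[] \<notin> rev ` Pi5"
      using rev_Pi5_length by force
    have "window [] 1 0 0 0"
      by (auto simp: window_def up_threshold_def down_threshold_def avoids_above_def
          no_123_below_def)
    then have "has_window_gf [] (window_gf True 0 0 0)"
      by (rule has_window_gfI) simp
    then show "has_window_gf [] common_gf"
      by (simp add: window_gf_def Cat_gf_sigma_0)
  qed
  then show ?thesis
    by (simp only: avoiders_gf_rev)
qed

section \<open>The classes of the form \<open>1 \<oplus> T\<close>\<close>

text \<open>For a property \<open>P u\<close> of the entries \<open>\<ge> u\<close>, the \<open>top_level\<close> is the largest \<open>k\<close> such that
  the \<open>k\<close> largest entries have it.\<close>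

definition top_level :: "nat \<Rightarrow> (nat \<Rightarrow> bool) \<Rightarrow> nat \<Rightarrow> bool" where
  "top_level n P k \<longleftrightarrow> k \<le> n \<and> up_threshold n P (Suc n - k)"

lemma top_levelD:
  assumes "top_level n P k"
  shows "k \<le> n" "1 \<le> u \<Longrightarrow> u \<le> Suc n \<Longrightarrow> P u \<longleftrightarrow> Suc n \<le> u + k"
  using assms up_thresholdD[of n P "Suc n - k" u] by (auto simp: top_level_def)

lemma top_level_prepend:
  assumes k: "top_level n P k" and "j \<le> k" "j \<le> k'" "k' \<le> Suc k"
    and P': "\<And>u. P' u \<longleftrightarrow> P (unbump (Suc n - j) u) \<and> (u \<le> Suc n - j \<longrightarrow> S u)"
    and S: "\<And>u. 1 \<le> u \<Longrightarrow> Suc n \<le> u + k \<Longrightarrow> u \<le> Suc n - j \<Longrightarrow> S u \<longleftrightarrow> Suc (Suc n) \<le> u + k'"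
  shows "top_level (Suc n) P' k'"
proof -
  have "k' \<le> Suc n"
    using assms(4) top_levelD(1)[OF k] by simp
  moreover have "up_threshold (Suc n) P' (Suc (Suc n) - k')"
    using k assms(2-4) S unfolding top_level_def
    by (intro up_threshold_prepend[OF _ _ _ _ _ P']) auto
  ultimately show ?thesis
    by (simp add: top_level_def)
qed

lemma top_level_prepend_below:
  assumes k: "top_level n P k" and "k < j" "j \<le> n"
    and P': "\<And>u. P' u \<longleftrightarrow> P (unbump (Suc n - j) u) \<and> (u \<le> Suc n - j \<longrightarrow> S u)"
  shows "top_level (Suc n) P' k"
proof -
  have "up_threshold (Suc n) P' (Suc (Suc n - k))"
    using k assms(2,3) unfolding top_level_def
    by (intro up_threshold_prepend_below[OF _ _ _ P']) auto
  then show ?thesis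
    using top_levelD(1)[OF k] by (simp add: top_level_def Suc_diff_le)
qed

definition level_state ::
  "(nat \<Rightarrow> nat \<Rightarrow> nat \<Rightarrow> bool) \<Rightarrow> (nat list \<Rightarrow> nat \<Rightarrow> bool) \<Rightarrow> nat list \<Rightarrow> nat \<Rightarrow> nat \<Rightarrow> bool" where
  "level_state R Q w k i \<longleftrightarrow> top_level (length w) (avoids_above R w) k \<and>
     top_level (length w) (Q w) i \<and> i \<le> k \<and> (w = [] \<or> 0 < i)"

lemma level_state_perms:
  "w \<in> perms n \<Longrightarrow> level_state R Q w k i \<longleftrightarrow>
    top_level n (avoids_above R w) k \<and> top_level n (Q w) i \<and> i \<le> k \<and> (n = 0 \<or> 0 < i)"
  using permsD(3)[of w n] by (auto simp: level_state_def)

lemma level_state_prepend: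
  "w \<in> perms n \<Longrightarrow> level_state R Q (prepend v w) k i \<longleftrightarrow>
    top_level (Suc n) (avoids_above R (prepend v w)) k \<and> top_level (Suc n) (Q (prepend v w)) i \<and>
    i \<le> k \<and> 0 < i"
  using permsD(3)[of w n] by (auto simp: level_state_def prepend_def)

lemma sites_avoids_above:
  assumes w: "w \<in> perms n" and T: "\<forall>\<tau>\<in>T. length \<tau> = 4"
    and matches: "\<And>v b c d. matches T [v, bump v b, bump v c, bump v d] \<longleftrightarrow>
      v \<le> b \<and> v \<le> c \<and> v \<le> d \<and> R b c d"
    and k: "top_level n (avoids_above R w) k"
  shows "sites T w = {Suc n - k..Suc n}"
proof -
  have "sites T w = {v \<in> {1..Suc n}. avoids_above R w v}"
    unfolding sites_length_4[OF T permsD(1)[OF w]] matches avoids_above_def permsD(3)[OF w] by blast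
  also have "\<dots> = {Suc n - k..Suc n}"
    using top_levelD[OF k] by auto
  finally show ?thesis .
qed

text \<open>In state \<open>(k, i)\<close> the child with \<open>j\<close> entries above the new one has state
  \<open>(K k i j, I k i j)\<close>.\<close>

lemma avoiders_gf_level_state:
  fixes f :: "nat \<Rightarrow> nat \<Rightarrow> real fps"
  assumes T: "\<forall>\<tau>\<in>T. length \<tau> = 4"
    and matches: "\<And>v b c d. matches T [v, bump v b, bump v c, bump v d] \<longleftrightarrow>
      v \<le> b \<and> v \<le> c \<and> v \<le> d \<and> R b c d"
    and root: "Q [] 1"
    and child: "\<And>n w k i j. w \<in> perms n \<Longrightarrow> level_state R Q w k i \<Longrightarrow> j \<le> k \<Longrightarrow>
      level_state R Q (prepend (Suc n - j) w) (K k i j) (I k i j)"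
    and f: "\<And>k i. i \<le> k \<Longrightarrow> k = 0 \<or> 0 < i \<Longrightarrow>
      f k i = 1 + fps_X * (\<Sum>j=0..k. f (K k i j) (I k i j))"
  shows "avoiders_gf T = f 0 0"
proof (rule avoiders_gf_eqI)
  let ?S = "\<lambda>w G. \<exists>k i. level_state R Q w k i \<and> G = f k i"
  show "[] \<notin> T"
    using T by force
  have "level_state R Q [] 0 0"
    using root by (simp add: level_state_def top_level_def up_threshold_def avoids_above_def)
  then show "?S [] (f 0 0)"
    by blast
  fix n w G assume w: "w \<in> perms n" and "?S w G"
  then obtain k i where state: "level_state R Q w k i" and G: "G = f k i"
    by blast
  then have k: "top_level n (avoids_above R w) k" and i: "i \<le> k" "n = 0 \<or> 0 < i"
    unfolding level_state_perms[OF w] by blast+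
  have sites: "sites T w = {Suc n - k..Suc n}"
    by (rule sites_avoids_above[OF w T matches k])
  define H where "H v = f (K k i (Suc n - v)) (I k i (Suc n - v))" for v
  have "sum H (sites T w) = (\<Sum>j=0..k. f (K k i j) (I k i j))"
    unfolding sites H_def using top_levelD(1)[OF k]
    by (intro sum.reindex_bij_witness[of _ "\<lambda>j. Suc n - j" "\<lambda>v. Suc n - v"]) auto
  then have "G = 1 + fps_X * sum H (sites T w)"
    using f[OF i(1)] i(2) top_levelD(1)[OF k] G by auto
  moreover have "children_sum ?S w (sites T w) (sum H (sites T w))"
  proof (rule children_sumI)
    fix v assume "v \<in> sites T w"
    then have "Suc n - (Suc n - v) = v" "Suc n - v \<le> k"
      by (auto simp: sites)
    then show "?S (prepend v w) (H v)"
      using child[OF w state, of "Suc n - v"] unfolding H_def by auto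
  qed
  ultimately show "\<exists>s. G = 1 + fps_X * s \<and> children_sum ?S w (sites T w) s"
    by blast
qed

text \<open>The solution of \<open>d\<^sub>i = 1 + x (C\<^sup>i d\<^sub>1 + d\<^sub>2 + \<dots> + d\<^sub>i\<^sub>+\<^sub>1)\<close>, the recurrence for the states
  with \<open>k = i\<close> in each of the three classes.\<close>

definition diag :: "nat \<Rightarrow> real fps" where
  "diag i = Cat ^ i * (common_gf + of_nat i * (Cat - 1)\<^sup>2 * inv_quad)"

lemma diag_0 [simp]: "diag 0 = common_gf"
  by (simp add: diag_def)

lemma diag_Suc_0: "diag (Suc 0) = Cat * delta"
  using inv_quad unfolding diag_def common_gf_def delta_def by simp algebra

lemma diag_step:
  "diag (Suc i) = diag i + fps_X * ((Cat ^ Suc i - Cat ^ i) * diag 1 + diag (Suc (Suc i)))"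
proof -
  have "P * Cat * (common_gf + (1 + m) * (Cat - 1)\<^sup>2 * inv_quad) =
      P * (common_gf + m * (Cat - 1)\<^sup>2 * inv_quad) + fps_X * ((Cat * P - P) * (Cat * delta) +
        P * Cat * Cat * (common_gf + (2 + m) * (Cat - 1)\<^sup>2 * inv_quad))" for P m
    using Cat_eq inv_quad unfolding common_gf_def delta_def by algebra
  from this[of "Cat ^ i" "of_nat i"] show ?thesis
    by (simp add: diag_Suc_0 diag_def[of "Suc (Suc i)"] diag_def[of "Suc i"] diag_def[of i]
        algebra_simps)
qed

lemma diag_sum: "diag i = 1 + fps_X * (Cat ^ i * diag 1 + (\<Sum>j=1..i. diag (Suc j)))"
proof (induction i)
  case 0
  show ?case
    by (simp add: diag_Suc_0 common_gf_eq_delta)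
next
  case (Suc i)
  show ?case
    by (subst diag_step, subst Suc) (simp add: algebra_simps)
qed

lemma sum_split_at:
  fixes g :: "nat \<Rightarrow> 'a :: comm_monoid_add"
  assumes "i \<le> k"
  shows "(\<Sum>j=0..k. g j) = g 0 + ((\<Sum>j=1..i. g j) + (\<Sum>j=Suc i..k. g j))"
proof -
  have "(\<Sum>j=1..k. g j) = (\<Sum>j=1..i. g j) + (\<Sum>j=Suc i..k. g j)"
    using sum.ub_add_nat[of 1 i g "k - i"] assms by simp
  then show ?thesis
    by (simp add: sum.atLeast_Suc_atMost)
qed

definition increasing_above :: "nat list \<Rightarrow> nat \<Rightarrow> bool" where
  "increasing_above w u \<longleftrightarrow> (\<forall>b c. before w b c \<longrightarrow> u \<le> b \<longrightarrow> u \<le> c \<longrightarrow> b < c)"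

lemma increasing_above_prepend:
  "increasing_above (prepend v w) u \<longleftrightarrow>
    increasing_above w (unbump v u) \<and> (u \<le> v \<longrightarrow> (\<forall>b\<in>set w. u \<le> b \<longrightarrow> v \<le> b))"
  unfolding increasing_above_def all_before_prepend le_bump_iff
  by (cases "u \<le> v") (simp_all add: unbump_def)

lemma increasing_above_prepend_level:
  assumes w: "w \<in> perms n" and i: "top_level n (increasing_above w) i" and j: "j \<le> n"
  shows "top_level (Suc n) (increasing_above (prepend (Suc n - j) w)) (if j \<le> i then Suc j else i)"
proof (cases "j \<le> i")
  case True
  have "(\<forall>b\<in>set w. u \<le> b \<longrightarrow> Suc n - j \<le> b) \<longleftrightarrow> Suc (Suc n) \<le> u + Suc j"
    if "1 \<le> u" "u \<le> Suc n - j" for u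
    using that j unfolding permsD(2)[OF w] by auto
  then show ?thesis
    using True by (auto intro!: top_level_prepend[OF i _ _ _ increasing_above_prepend])
next
  case False
  then show ?thesis
    using top_level_prepend_below[OF i _ j increasing_above_prepend] by simp
qed

lemma ex_start_if_straddling:
  assumes w: "w \<in> perms n" and uv: "1 \<le> u" "u < v" "v \<le> n"
    and R: "\<And>b c. b < v \<and> v \<le> c \<or> c < v \<and> v \<le> b \<Longrightarrow> R v (bump v b) (bump v c)"
  shows "\<exists>b c. before w b c \<and> u \<le> b \<and> u \<le> c \<and> R v (bump v b) (bump v c)"
proof -
  have "before w (v - 1) v \<or> before w v (v - 1)"
    using uv by (intro before_total) (auto simp: permsD(2)[OF w])
  moreover have "u \<le> v - 1" "v - 1 < v"
    using uv by simp_all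
  ultimately show ?thesis
    using uv(2) R by (meson less_imp_le order_refl)
qed

abbreviation is_213_231_321 :: "nat \<Rightarrow> nat \<Rightarrow> nat \<Rightarrow> bool" where
  "is_213_231_321 b c d \<equiv> c < b \<and> b < d \<or> d < b \<and> b < c \<or> d < c \<and> c < b"

lemma matches_Pi3:
  "matches Pi3 [v, bump v b, bump v c, bump v d] \<longleftrightarrow>
    v \<le> b \<and> v \<le> c \<and> v \<le> d \<and> is_213_231_321 b c d"
  unfolding matches_def Pi3_def by (simp add: order_isomorphic_patterns del: One_nat_def) linarith

lemma Pi3_child_level:
  assumes w: "w \<in> perms n" and k: "top_level n (avoids_above is_213_231_321 w) k"
    and i: "top_level n (increasing_above w) i" and "i \<le> k" "j \<le> k"
  shows "top_level (Suc n) (avoids_above is_213_231_321 (prepend (Suc n - j) w))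
    (if j = 0 then Suc i else Suc j)"
proof (rule top_level_prepend[OF k _ _ _ avoids_above_prepend])
  let ?v = "Suc n - j"
  fix u assume u: "1 \<le> u" "u \<le> ?v"
  show "(\<forall>b c. before w b c \<longrightarrow> u \<le> b \<longrightarrow> u \<le> c \<longrightarrow> \<not> is_213_231_321 ?v (bump ?v b) (bump ?v c)) \<longleftrightarrow>
    Suc (Suc n) \<le> u + (if j = 0 then Suc i else Suc j)" (is "?S \<longleftrightarrow> _")
  proof -
    consider (top) "j = 0" | (boundary) "0 < j" "u = ?v" | (below) "0 < j" "u < ?v"
      using u(2) by linarith
    then show ?thesis
    proof cases
      case top
      have "?S \<longleftrightarrow> increasing_above w u"
        using top before_permsD[OF w] unfolding increasing_above_def by (fastforce simp: not_less)
      then show ?thesis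
        using top u top_levelD(2)[OF i, of u] by auto
    next
      case boundary
      then show ?thesis
        using before_permsD[OF w] by auto
    next
      case below
      then have "\<exists>b c. before w b c \<and> u \<le> b \<and> u \<le> c \<and> is_213_231_321 ?v (bump ?v b) (bump ?v c)"
        by (intro ex_start_if_straddling[OF w u(1)]) auto
      then have "\<not> ?S"
        by blast
      then show ?thesis
        using below by auto
    qed
  qed
qed (use assms in auto)

lemma Pi3_child:
  assumes w: "w \<in> perms n" and "level_state is_213_231_321 increasing_above w k i"
    and j: "j \<le> k"
  shows "level_state is_213_231_321 increasing_above (prepend (Suc n - j) w)
    (if j = 0 then Suc i else Suc j) (if j \<le> i then Suc j else i)"
proof -
  have k: "top_level n (avoids_above is_213_231_321 w) k"
    and i: "top_level n (increasing_above w) i" and "i \<le> k" "n = 0 \<or> 0 < i"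
    using assms(2) unfolding level_state_perms[OF w] by blast+
  then show ?thesis
    unfolding level_state_prepend[OF w]
    using Pi3_child_level[OF w k i _ j] increasing_above_prepend_level[OF w i, of j] j
      top_levelD(1)[OF k] by auto
qed

lemma avoiders_gf_Pi3: "avoiders_gf Pi3 = common_gf"
proof -
  define f where "f k i = Cat ^ (k - i) * diag i" for k i
  have "avoiders_gf Pi3 = f 0 0"
  proof (rule avoiders_gf_level_state[OF _ matches_Pi3 _ Pi3_child, where f = f])
    show "\<forall>\<tau>\<in>Pi3. length \<tau> = 4" "increasing_above [] 1"
      by (simp_all add: Pi3_def increasing_above_def)
  next
    fix k i :: nat assume "i \<le> k"
    let ?g = "\<lambda>j. f (if j = 0 then Suc i else Suc j) (if j \<le> i then Suc j else i)"
    have "(\<Sum>t<k - i. Cat\<^sup>2 * Cat ^ t * diag i) = (\<Sum>j=Suc i..k. ?g j)"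
      by (rule sum.reindex_bij_witness[of _ "\<lambda>j. j - Suc i" "\<lambda>t. Suc i + t"])
        (auto simp: f_def power2_eq_square mult.assoc)
    then have "(\<Sum>j=Suc i..k. ?g j) = Cat\<^sup>2 * (\<Sum>t<k - i. Cat ^ t) * diag i"
      by (simp add: sum_distrib_left sum_distrib_right)
    then have "fps_X * (\<Sum>j=Suc i..k. ?g j) = (Cat ^ (k - i) - 1) * diag i"
      by (simp only: Cat_geometric_sum[symmetric] mult.assoc)
    moreover have "(\<Sum>j=1..i. ?g j) = (\<Sum>j=1..i. diag (Suc j))"
      by (intro sum.cong) (auto simp: f_def)
    moreover have "?g 0 = Cat ^ i * diag 1"
      by (simp add: f_def)
    ultimately have "1 + fps_X * (\<Sum>j=0..k. ?g j) =
        1 + fps_X * (Cat ^ i * diag 1 + (\<Sum>j=1..i. diag (Suc j))) + (Cat ^ (k - i) - 1) * diag i"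
      unfolding sum_split_at[OF \<open>i \<le> k\<close>] by (simp only: distrib_left add.assoc)
    then show "f k i = 1 + fps_X * (\<Sum>j=0..k. ?g j)"
      unfolding diag_sum[symmetric] by (simp add: f_def algebra_simps)
  qed
  then show ?thesis
    by (simp add: f_def)
qed

abbreviation is_132_213_231 :: "nat \<Rightarrow> nat \<Rightarrow> nat \<Rightarrow> bool" where
  "is_132_213_231 b c d \<equiv> b < d \<and> d < c \<or> c < b \<and> b < d \<or> d < b \<and> b < c"

lemma matches_Pi2:
  "matches Pi2 [v, bump v b, bump v c, bump v d] \<longleftrightarrow>
    v \<le> b \<and> v \<le> c \<and> v \<le> d \<and> is_132_213_231 b c d"
  unfolding matches_def Pi2_def by (simp add: order_isomorphic_patterns del: One_nat_def) linarith

lemma Pi2_child_level: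
  assumes w: "w \<in> perms n" and k: "top_level n (avoids_above is_132_213_231 w) k"
    and i: "top_level n (increasing_above w) i" and "i \<le> k" "j \<le> k"
  shows "top_level (Suc n) (avoids_above is_132_213_231 (prepend (Suc n - j) w))
    (if j = 0 then Suc k else if j \<le> i then Suc j else j)"
proof (rule top_level_prepend[OF k _ _ _ avoids_above_prepend])
  let ?v = "Suc n - j"
  fix u assume u: "1 \<le> u" "Suc n \<le> u + k" "u \<le> ?v"
  show "(\<forall>b c. before w b c \<longrightarrow> u \<le> b \<longrightarrow> u \<le> c \<longrightarrow> \<not> is_132_213_231 ?v (bump ?v b) (bump ?v c)) \<longleftrightarrow>
    Suc (Suc n) \<le> u + (if j = 0 then Suc k else if j \<le> i then Suc j else j)" (is "?S \<longleftrightarrow> _")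
  proof -
    consider (top) "j = 0" | (boundary) "0 < j" "u = ?v" | (below) "0 < j" "u < ?v"
      using u(3) by linarith
    then show ?thesis
    proof cases
      case top
      then show ?thesis
        using u before_permsD[OF w] by fastforce
    next
      case boundary
      have "?S \<longleftrightarrow> increasing_above w u"
        using boundary(2) before_permsD[OF w] unfolding increasing_above_def
        by (fastforce simp: not_less)
      then show ?thesis
        using boundary u top_levelD(2)[OF i, of u] by auto
    next
      case below
      then have "\<exists>b c. before w b c \<and> u \<le> b \<and> u \<le> c \<and> is_132_213_231 ?v (bump ?v b) (bump ?v c)"
        by (intro ex_start_if_straddling[OF w u(1)]) auto
      then have "\<not> ?S"
        by blast
      then show ?thesis
        using below by auto
    qed
  qed
qed (use assms in auto)

lemma Pi2_child:
  assumes w: "w \<in> perms n" and "level_state is_132_213_231 increasing_above w k i"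
    and j: "j \<le> k"
  shows "level_state is_132_213_231 increasing_above (prepend (Suc n - j) w)
    (if j = 0 then Suc k else if j \<le> i then Suc j else j) (if j \<le> i then Suc j else i)"
proof -
  have k: "top_level n (avoids_above is_132_213_231 w) k"
    and i: "top_level n (increasing_above w) i" and "i \<le> k" "n = 0 \<or> 0 < i"
    using assms(2) unfolding level_state_perms[OF w] by blast+
  then show ?thesis
    unfolding level_state_prepend[OF w]
    using Pi2_child_level[OF w k i _ j] increasing_above_prepend_level[OF w i, of j] j
      top_levelD(1)[OF k] by auto
qed

definition decreasing_but_max_above :: "nat list \<Rightarrow> nat \<Rightarrow> bool" where
  "decreasing_but_max_above w u \<longleftrightarrow>
     (\<forall>b c. before w b c \<longrightarrow> u \<le> b \<longrightarrow> u \<le> c \<longrightarrow> b \<noteq> length w \<and> (c < b \<or> c = length w))"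

lemma decreasing_but_max_above_prepend:
  assumes w: "w \<in> perms n" and v: "v \<le> n"
  shows "decreasing_but_max_above (prepend v w) u \<longleftrightarrow> decreasing_but_max_above w (unbump v u) \<and>
    (u \<le> v \<longrightarrow> (\<forall>c\<in>{1..n}. u \<le> c \<longrightarrow> c < v \<or> c = n))"
proof -
  have bump: "bump v c = Suc n \<longleftrightarrow> c = n" for c
    using v by (auto simp: bump_def)
  have "decreasing_but_max_above (prepend v w) u \<longleftrightarrow>
    (\<forall>b c. before w b c \<longrightarrow> unbump v u \<le> b \<longrightarrow> unbump v u \<le> c \<longrightarrow>
      bump v b \<noteq> Suc n \<and> (c < b \<or> bump v c = Suc n)) \<and>
    (u \<le> v \<longrightarrow> (\<forall>c\<in>{1..n}. u \<le> c \<longrightarrow> c < v \<or> bump v c = Suc n))"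
    unfolding decreasing_but_max_above_def all_before_prepend le_bump_iff length_prepend
      permsD(2,3)[OF w] using v by (cases "u \<le> v") (simp_all add: unbump_def)
  then show ?thesis
    unfolding bump decreasing_but_max_above_def permsD(3)[OF w] .
qed

lemma decreasing_but_max_above_prepend_max:
  assumes w: "w \<in> perms n"
  shows "top_level (Suc n) (decreasing_but_max_above (prepend (Suc n) w)) 1"
proof -
  have "decreasing_but_max_above (prepend (Suc n) w) u \<longleftrightarrow> n < u" if u: "1 \<le> u" for u
  proof
    assume "decreasing_but_max_above (prepend (Suc n) w) u"
    then have "\<forall>c\<in>{1..n}. \<not> u \<le> bump (Suc n) c" if "u \<le> Suc n"
      using that unfolding decreasing_but_max_above_def all_before_prepend length_prepend
        permsD(2,3)[OF w] by blast
    then show "n < u"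
      using u by (cases "u \<le> n") (auto simp: bump_def)
  next
    assume "n < u"
    then show "decreasing_but_max_above (prepend (Suc n) w) u"
      using before_permsD[OF w] permsD[OF w]
      by (fastforce simp: decreasing_but_max_above_def before_prepend bump_def)
  qed
  then show ?thesis
    by (auto simp: top_level_def up_threshold_def)
qed

lemma decreasing_but_max_above_prepend_level:
  assumes w: "w \<in> perms n" and i: "top_level n (decreasing_but_max_above w) i"
    and i0: "n = 0 \<or> 0 < i" and j: "j \<le> n"
  shows "top_level (Suc n) (decreasing_but_max_above (prepend (Suc n - j) w))
    (if j = 0 then 1 else if j = 1 then Suc i else min i j)"
proof -
  consider (max) "j = 0" | (within) "0 < j" "j \<le> i" | (beyond) "i < j"
    by linarith
  then show ?thesis
  proof cases
    case max
    then show ?thesis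
      using decreasing_but_max_above_prepend_max[OF w] by simp
  next
    case within
    let ?v = "Suc n - j"
    have v: "?v \<in> {1..n}"
      using within j by auto
    have "top_level (Suc n) (decreasing_but_max_above (prepend ?v w)) (if j = 1 then Suc i else j)"
    proof (rule top_level_prepend[OF i _ _ _ decreasing_but_max_above_prepend[OF w]])
      fix u assume u: "Suc n \<le> u + i" "u \<le> ?v"
      have "(\<forall>c\<in>{1..n}. u \<le> c \<longrightarrow> c < ?v \<or> c = n) \<longleftrightarrow> j = 1"
      proof
        assume "\<forall>c\<in>{1..n}. u \<le> c \<longrightarrow> c < ?v \<or> c = n"
        then have "?v = n"
          using v u(2) by blast
        then show "j = 1"
          using v by simp
      qed auto
      then show "(\<forall>c\<in>{1..n}. u \<le> c \<longrightarrow> c < ?v \<or> c = n) \<longleftrightarrow>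
          Suc (Suc n) \<le> u + (if j = 1 then Suc i else j)"
        using u within(1) j by auto
    qed (use within v in auto)
    then show ?thesis
      using within by (auto simp: min_def)
  next
    case beyond
    then have "top_level (Suc n) (decreasing_but_max_above (prepend (Suc n - j) w)) i"
      by (intro top_level_prepend_below[OF i _ j decreasing_but_max_above_prepend[OF w]]) auto
    then show ?thesis
      using beyond i0 j by (auto simp: min_def)
  qed
qed

abbreviation is_123_132_231 :: "nat \<Rightarrow> nat \<Rightarrow> nat \<Rightarrow> bool" where
  "is_123_132_231 b c d \<equiv> b < c \<and> c < d \<or> b < d \<and> d < c \<or> d < b \<and> b < c"

lemma matches_Pi1:
  "matches Pi1 [v, bump v b, bump v c, bump v d] \<longleftrightarrow>
    v \<le> b \<and> v \<le> c \<and> v \<le> d \<and> is_123_132_231 b c d"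
  unfolding matches_def Pi1_def by (simp add: order_isomorphic_patterns del: One_nat_def) linarith

lemma is_123_132_231_bump_iff:
  "b \<noteq> c \<Longrightarrow> is_123_132_231 v (bump v b) (bump v c) \<longleftrightarrow> v \<le> b"
  by (auto simp: bump_def)

lemma max_not_before_iff_decreasing_but_max_above:
  assumes w: "w \<in> perms n" and avoids: "avoids_above is_123_132_231 w u"
  shows "(\<forall>c. u \<le> c \<longrightarrow> \<not> before w n c) \<longleftrightarrow> decreasing_but_max_above w u"
proof
  assume max: "\<forall>c. u \<le> c \<longrightarrow> \<not> before w n c"
  have "c < b \<or> c = n" if bc: "before w b c" "u \<le> b" "u \<le> c" for b c
  proof (rule ccontr)
    assume "\<not> (c < b \<or> c = n)"
    then have "b < c" "c < n"
      using before_permsD[OF w bc(1)] by auto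
    then have "before w c n"
      using before_total[of c w n] before_permsD[OF w bc(1)] max bc(3) permsD(2)[OF w] by auto
    then show False
      using avoids bc \<open>b < c\<close> \<open>c < n\<close> unfolding avoids_above_def
      by (meson less_imp_le order_trans)
  qed
  then show "decreasing_but_max_above w u"
    using max unfolding decreasing_but_max_above_def permsD(3)[OF w] by blast
next
  assume dec: "decreasing_but_max_above w u"
  show "\<forall>c. u \<le> c \<longrightarrow> \<not> before w n c"
  proof (intro allI impI notI)
    fix c assume "u \<le> c" "before w n c"
    then have "u \<le> n"
      using before_permsD[OF w, of n c] by simp
    then show False
      using dec \<open>u \<le> c\<close> \<open>before w n c\<close> unfolding decreasing_but_max_above_def permsD(3)[OF w]
      by blast
  qed
qed

lemma all_before_less_iff_level:
  assumes w: "w \<in> perms n" and k: "top_level n (avoids_above is_123_132_231 w) k"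
    and i: "top_level n (decreasing_but_max_above w) i"
    and u: "1 \<le> u" "Suc n \<le> u + k" "u \<le> Suc n - j"
  shows "(\<forall>b c. before w b c \<longrightarrow> u \<le> c \<longrightarrow> b < Suc n - j) \<longleftrightarrow>
    Suc (Suc n) \<le> u + (if j = 0 then Suc k else if j = 1 then Suc i else j)"
proof -
  consider (top) "j = 0" | (second) "j = 1" | (below) "2 \<le> j"
    by linarith
  then show ?thesis
  proof cases
    case top
    then show ?thesis
      using before_permsD[OF w] u by (auto simp: less_Suc_eq_le)
  next
    case second
    have avoids: "avoids_above is_123_132_231 w u"
      using top_levelD(2)[OF k u(1)] u by linarith
    have "(\<forall>b c. before w b c \<longrightarrow> u \<le> c \<longrightarrow> b < Suc n - j) \<longleftrightarrow> (\<forall>c. u \<le> c \<longrightarrow> \<not> before w n c)"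
      unfolding second using before_permsD[OF w] by (fastforce simp: nat_less_le)
    also have "\<dots> \<longleftrightarrow> decreasing_but_max_above w u"
      by (rule max_not_before_iff_decreasing_but_max_above[OF w avoids])
    also have "\<dots> \<longleftrightarrow> Suc n \<le> u + i"
      using top_levelD(2)[OF i, of u] u by auto
    finally show ?thesis
      using second by simp
  next
    case below
    then have "before w n (Suc n - j) \<or> before w (Suc n - j) n"
      using u by (intro before_total) (auto simp: permsD(2)[OF w])
    then show ?thesis
      using below u by fastforce
  qed
qed

lemma Pi1_child_level:
  assumes w: "w \<in> perms n" and k: "top_level n (avoids_above is_123_132_231 w) k"
    and i: "top_level n (decreasing_but_max_above w) i" and "i \<le> k" "j \<le> k"
  shows "top_level (Suc n) (avoids_above is_123_132_231 (prepend (Suc n - j) w))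
    (if j = 0 then Suc k else if j = 1 then Suc i else j)"
proof (rule top_level_prepend[OF k _ _ _ avoids_above_prepend])
  let ?v = "Suc n - j"
  fix u assume u: "1 \<le> u" "Suc n \<le> u + k" "u \<le> ?v"
  have starts: "is_123_132_231 ?v (bump ?v b) (bump ?v c) \<longleftrightarrow> ?v \<le> b" if "before w b c" for b c
    using is_123_132_231_bump_iff before_permsD[OF w that] by blast
  have "(\<forall>b c. before w b c \<longrightarrow> u \<le> b \<longrightarrow> u \<le> c \<longrightarrow> \<not> is_123_132_231 ?v (bump ?v b) (bump ?v c)) \<longleftrightarrow>
    (\<forall>b c. before w b c \<longrightarrow> u \<le> b \<longrightarrow> u \<le> c \<longrightarrow> \<not> ?v \<le> b)" (is "?S \<longleftrightarrow> _")
    using starts by blast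
  also have "\<dots> \<longleftrightarrow> (\<forall>b c. before w b c \<longrightarrow> u \<le> c \<longrightarrow> b < ?v)"
    using u(3) by (meson le_trans not_le)
  also have "\<dots> \<longleftrightarrow> Suc (Suc n) \<le> u + (if j = 0 then Suc k else if j = 1 then Suc i else j)"
    by (rule all_before_less_iff_level[OF w k i u])
  finally show "?S \<longleftrightarrow> Suc (Suc n) \<le> u + (if j = 0 then Suc k else if j = 1 then Suc i else j)" .
qed (use assms in auto)

lemma Pi1_child:
  assumes w: "w \<in> perms n" and "level_state is_123_132_231 decreasing_but_max_above w k i"
    and j: "j \<le> k"
  shows "level_state is_123_132_231 decreasing_but_max_above (prepend (Suc n - j) w)
    (if j = 0 then Suc k else if j = 1 then Suc i else j)
    (if j = 0 then 1 else if j = 1 then Suc i else min i j)"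
proof -
  have k: "top_level n (avoids_above is_123_132_231 w) k"
    and i: "top_level n (decreasing_but_max_above w) i" and "i \<le> k" "n = 0 \<or> 0 < i"
    using assms(2) unfolding level_state_perms[OF w] by blast+
  then show ?thesis
    unfolding level_state_prepend[OF w]
    using Pi1_child_level[OF w k i _ j] decreasing_but_max_above_prepend_level[OF w i, of j] j
      top_levelD(1)[OF k] by auto
qed

definition geom :: "real fps" where
  "geom = inverse (1 - fps_X)"

lemma geom_eq: "geom = 1 + fps_X * geom"
proof -
  have "geom * (1 - fps_X) = 1"
    unfolding geom_def by (rule inverse_mult_eq_1) simp
  then show ?thesis
    by (simp add: algebra_simps)
qed

text \<open>For fixed \<open>i\<close> the recurrence in \<open>k\<close> is \<open>(1 - x) f\<^sub>k = f\<^sub>k\<^sub>-\<^sub>1 + x (C - 1) \<delta> C\<^sup>k\<close>, and \<open>\<delta> C\<^sup>k\<close>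
  is a particular solution.\<close>

definition off_diag :: "nat \<Rightarrow> nat \<Rightarrow> real fps" where
  "off_diag k i = delta * Cat ^ k + (diag i - delta * Cat ^ i) * geom ^ (k - i)"

lemma off_diag_same [simp]: "off_diag i i = diag i"
  by (simp add: off_diag_def)

lemma off_diag_1: "off_diag k 1 = delta * Cat ^ k"
  by (simp add: off_diag_def diag_Suc_0)

lemma off_diag_Suc:
  assumes "i \<le> k"
  shows "off_diag (Suc k) i = off_diag k i +
    fps_X * (off_diag (Suc (Suc k)) 1 - off_diag (Suc k) 1 + off_diag (Suc k) i)"
proof -
  have "delta * (Cat * P) + E * (geom * Q) = delta * P + E * Q +
      fps_X * (delta * (Cat * (Cat * P)) - delta * (Cat * P) +
        (delta * (Cat * P) + E * (geom * Q)))"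
    for P Q E
    using Cat_eq geom_eq by algebra
  from this[of "Cat ^ k" "diag i - delta * Cat ^ i" "geom ^ (k - i)"] show ?thesis
    by (simp only: off_diag_1) (simp only: off_diag_def Suc_diff_le[OF assms] power_Suc)
qed

lemma off_diag_sum:
  assumes "i \<le> k"
  shows "off_diag k i = 1 + fps_X * (off_diag (Suc k) 1 +
    ((\<Sum>j=1..i. diag (Suc j)) + (\<Sum>j=Suc i..k. off_diag j i)))"
  using assms
proof (induction k rule: dec_induct)
  case base
  have "off_diag (Suc i) 1 = Cat ^ i * diag 1"
    unfolding off_diag_1 by (simp add: diag_Suc_0 algebra_simps)
  then show ?case
    using diag_sum[of i] by simp
next
  case (step k)
  then show ?case
    using off_diag_Suc[OF step(1)] by (simp add: algebra_simps)
qed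

lemma avoiders_gf_Pi2: "avoiders_gf Pi2 = common_gf"
proof -
  have "avoiders_gf Pi2 = off_diag 0 0"
  proof (rule avoiders_gf_level_state[OF _ matches_Pi2 _ Pi2_child, where f = off_diag])
    show "\<forall>\<tau>\<in>Pi2. length \<tau> = 4" "increasing_above [] 1"
      by (simp_all add: Pi2_def increasing_above_def)
  next
    fix k i :: nat assume "i \<le> k"
    let ?g = "\<lambda>j. off_diag (if j = 0 then Suc k else if j \<le> i then Suc j else j)
      (if j \<le> i then Suc j else i)"
    have "(\<Sum>j=1..i. ?g j) = (\<Sum>j=1..i. diag (Suc j))"
      "(\<Sum>j=Suc i..k. ?g j) = (\<Sum>j=Suc i..k. off_diag j i)"
      by (intro sum.cong; auto)+
    then show "off_diag k i = 1 + fps_X * (\<Sum>j=0..k. ?g j)"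
      using off_diag_sum[OF \<open>i \<le> k\<close>] unfolding sum_split_at[OF \<open>i \<le> k\<close>] by simp
  qed
  then show ?thesis
    by simp
qed

lemma avoiders_gf_Pi1: "avoiders_gf Pi1 = common_gf"
proof -
  have "avoiders_gf Pi1 = off_diag 0 0"
  proof (rule avoiders_gf_level_state[OF _ matches_Pi1 _ Pi1_child, where f = off_diag])
    show "\<forall>\<tau>\<in>Pi1. length \<tau> = 4" "decreasing_but_max_above [] 1"
      by (simp_all add: Pi1_def decreasing_but_max_above_def)
  next
    fix k i :: nat assume "i \<le> k" and i: "k = 0 \<or> 0 < i"
    let ?g = "\<lambda>j. off_diag (if j = 0 then Suc k else if j = 1 then Suc i else j)
      (if j = 0 then 1 else if j = 1 then Suc i else min i j)"
    have "(\<Sum>j=1..i. ?g j) = (\<Sum>j=1..i. diag (Suc j))"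
    proof (cases i)
      case (Suc i')
      have "(\<Sum>j=1..i. ?g j) = ?g 1 + (\<Sum>j=Suc 1..i. ?g j)"
        using Suc by (intro sum.atLeast_Suc_atMost) simp
      also have "(\<Sum>j=Suc 1..i. ?g j) = (\<Sum>j=Suc 1..i. diag j)"
        by (intro sum.cong) auto
      also have "?g 1 + (\<Sum>j=Suc 1..i. diag j) = (\<Sum>j=Suc 1..Suc i. diag j)"
        using Suc by simp
      also have "\<dots> = (\<Sum>j=1..i. diag (Suc j))"
        by (rule sum.shift_bounds_cl_Suc_ivl)
      finally show ?thesis .
    qed simp
    moreover have "(\<Sum>j=Suc i..k. ?g j) = (\<Sum>j=Suc i..k. off_diag j i)"
      using i by (intro sum.cong) auto
    ultimately show "off_diag k i = 1 + fps_X * (\<Sum>j=0..k. ?g j)"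
      using off_diag_sum[OF \<open>i \<le> k\<close>] unfolding sum_split_at[OF \<open>i \<le> k\<close>] by simp
  qed
  then show ?thesis
    by simp
qed

theorem theorem1:
  shows "\<forall>T \<in> {Pi1, Pi2, Pi3, Pi4, Pi5}.
    avoiders_gf T =
      (1 - 5 * fps_X + (1 + fps_X) * sqrt_1_minus_4X) /
      (1 - 5 * fps_X + (1 - fps_X) * sqrt_1_minus_4X)"
  unfolding common_gf_eq
  by (simp add: avoiders_gf_Pi1 avoiders_gf_Pi2 avoiders_gf_Pi3 avoiders_gf_Pi4 avoiders_gf_Pi5)

end
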